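(* Let $\{A_n\}_{n\ge0}$ be a sequence of bounded self-adjoint operators on a complex Hilbert space $\mathcal{H}$ with $A_0=I$, admitting a self-adjoint dilation. Define operators $B_{ij}$ on $\mathcal{H}$ recursively as follows. Put $B_{ij}=0$ for $|i-j|>1$, $B_{(n-1)n}=B_{n(n-1)}^*$ for $n\ge1$, $B_{00}=A_1$, $P_0=I$, and, for $n=1,2,3,\dots$ successively, $$B_{n(n-1)}=\Big((P_{n-1}^* )^{-1}F_n\,P_{n-1}^{-1}\Big)^{1/2},\qquad P_n=B_{n(n-1)}B_{(n-1)(n-2)}\cdots B_{10},\qquad B_{nn}=(P_n^* )^{-1}E_n\,P_n^{-1},$$ where $$F_n=A_{2n}-\sum_{(r_1,\dots,r_{2n-1}),\ r_n\ne n}B_{0r_1}B_{r_1r_2}\cdots B_{r_{2n-1}0},$$ $$E_n=A_{2n+1}-\sum_{(r_1,\dots,r_{2n}),\ (r_n,r_{n+1})\ne(n,n)}B_{0r_1}B_{r_1r_2}\cdots B_{r_{2n}0},$$ and the sums run over tuples of nonnegative integers whose consecutive entries in $(0,r_1,r_2,\dots,0)$ (including the initial and final $0$) differ by at most $1$. If the inverses appearing in these recurrence relations are well-defined bounded operators (that is, at every stage $P_n$ is boundedly invertible), then these formulae provide a self-adjoint minimal dilation of $\{A_n\}_{n\ge0}$ with block tri-diagonal form: the block matrix $$B=\begin{bmatrix} B_{00}&B_{10}^*&0&0&\cdots\\ B_{10}&B_{11}&B_{21}^*&0&\cdots\\ 0&B_{21}&B_{22}&B_{32}^*&\cdots\\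 0&0&B_{32}&B_{33}&\cdots\\ \vdots&\vdots&\vdots&\ddots&\ddots\end{bmatrix}$$ on $\mathcal{K}=\mathcal{H}\oplus\mathcal{H}\oplus\mathcal{H}\oplus\cdots$, with $\mathcal{H}$ identified with the $0$-th summand, is well defined and is a minimal self-adjoint dilation of $\{A_n\}_{n\ge0}$.
   Context: A self-adjoint dilation of $\{A_n\}_{n\ge0}$ is a bounded self-adjoint operator $B$ on a Hilbert space $\mathcal{K}\supseteq\mathcal{H}$ such that $A_n=P_{\mathcal{H}}B^n|_{\mathcal{H}}$ for all $n\ge0$, with $P_{\mathcal{H}}$ the orthogonal projection onto $\mathcal{H}$; it is minimal if $\mathcal{K}=\overline{\mathrm{span}}\{B^nh:h\in\mathcal{H},n\ge0\}$. The restriction on tuples only discards products that contain a zero factor $B_{ij}$ with $|i-j|>1$; with it, the sum in $F_n$ involves only blocks $B_{ij}$ with $i,j\le n-1$, and the sum in $E_n$ involves only blocks $B_{ij}$ with $i,j\le n$, $(i,j)\ne(n,n)$. The square root is the positive square root. For example $B_{10}=(A_2-A_1^2)^{1/2}$ and $B_{11}=B_{10}^{-1}\big[(A_3-A_1^3)-A_1(A_2-A_1^2)-(A_2-A_1^2)A_1\big]B_{10}^{-1}$. *)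

theory Defs
  imports "HOL-Analysis.Analysis"
begin

section \<open>Complex Hilbert spaces\<close>

text \<open>
  A complex inner product space is a real one carrying a compatible complex structure. The complex
  inner product is linear in its first argument; since its real part is the real inner product,
  positive definiteness, the norm \<open>norm x = sqrt (Re (cinner x x))\<close> and the topology are those of
  \<^class>\<open>real_inner\<close>.
\<close>

class complex_inner = real_inner +
  fixes scaleC :: "complex \<Rightarrow> 'a \<Rightarrow> 'a"
    and cinner :: "'a \<Rightarrow> 'a \<Rightarrow> complex"
  assumes scaleC_add_right: "scaleC c (x + y) = scaleC c x + scaleC c y"
    and scaleC_add_left: "scaleC (c + d) x = scaleC c x + scaleC d x"
    and scaleC_scaleC: "scaleC c (scaleC d x) = scaleC (c * d) x"
    and scaleR_scaleC: "scaleR r x = scaleC (complex_of_real r) x"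
    and cinner_commute: "cinner x y = cnj (cinner y x)"
    and cinner_add_left: "cinner (x + y) z = cinner x z + cinner y z"
    and cinner_scaleC_left: "cinner (scaleC c x) y = c * cinner x y"
    and inner_eq_Re_cinner: "inner x y = Re (cinner x y)"

class chilbert_space = complex_inner + complete_space

instantiation complex :: chilbert_space
begin

definition scaleC_complex :: "complex \<Rightarrow> complex \<Rightarrow> complex" where "scaleC_complex c x = c * x"
definition cinner_complex :: "complex \<Rightarrow> complex \<Rightarrow> complex" where "cinner_complex x y = x * cnj y"

instance
  by standard
    (simp_all add: scaleC_complex_def cinner_complex_def inner_complex_def algebra_simps scaleR_conv_of_real)

end

lemma Im_cinner: "Im (cinner x y) = inner (scaleC (- \<i>) x) (y :: 'a::complex_inner)"
  by (simp add: inner_eq_Re_cinner cinner_scaleC_left)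

lemma norm_scaleC: "norm (scaleC c x) = cmod c * norm (x :: 'a::complex_inner)"
proof -
  have im: "Im (cinner x x) = 0"
    using cinner_commute[of x x] by (metis complex_cnj cnj.simps(2) equal_neg_zero)
  have "cinner (scaleC c x) (scaleC c x) = c * cnj c * cinner x x"
    by (metis cinner_commute cinner_scaleC_left complex_cnj_mult mult.assoc mult.commute)
  also have "\<dots> = complex_of_real ((cmod c)\<^sup>2) * cinner x x"
    by (simp only: complex_norm_square)
  finally have "(norm (scaleC c x))\<^sup>2 = (cmod c * norm x)\<^sup>2"
    by (simp add: power2_norm_eq_inner inner_eq_Re_cinner power_mult_distrib im)
  then show ?thesis by simp
qed

section \<open>The Hilbert space of square-summable sequences\<close>

lemma summable_norm_sq_add:
  fixes f g :: "nat \<Rightarrow> 'a::real_inner"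
  assumes "summable (\<lambda>n. (norm (f n))\<^sup>2)" "summable (\<lambda>n. (norm (g n))\<^sup>2)"
  shows "summable (\<lambda>n. (norm (f n + g n))\<^sup>2)"
proof (rule summable_comparison_test')
  show "summable (\<lambda>n. 2 * (norm (f n))\<^sup>2 + 2 * (norm (g n))\<^sup>2)"
    using assms by (intro summable_add summable_mult)
  fix n :: nat
  have "(norm (f n + g n))\<^sup>2 + (norm (f n - g n))\<^sup>2 = 2 * (norm (f n))\<^sup>2 + 2 * (norm (g n))\<^sup>2"
    by (simp add: power2_norm_eq_inner inner_add inner_diff inner_commute)
  then show "norm ((norm (f n + g n))\<^sup>2) \<le> 2 * (norm (f n))\<^sup>2 + 2 * (norm (g n))\<^sup>2"
    using zero_le_power2[of "norm (f n - g n)"] zero_le_power2[of "norm (f n + g n)"]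
    unfolding real_norm_def by linarith
qed

lemma summable_norm_sq_inner:
  fixes f g :: "nat \<Rightarrow> 'a::real_inner"
  assumes "summable (\<lambda>n. (norm (f n))\<^sup>2)" "summable (\<lambda>n. (norm (g n))\<^sup>2)"
  shows "summable (\<lambda>n. inner (f n) (g n))"
proof (rule summable_comparison_test')
  show "summable (\<lambda>n. (norm (f n))\<^sup>2 + (norm (g n))\<^sup>2)"
    using assms by (intro summable_add)
  fix n :: nat
  have "norm (inner (f n) (g n)) \<le> norm (f n) * norm (g n)"
    by (simp add: Cauchy_Schwarz_ineq2)
  also have "\<dots> \<le> (norm (f n))\<^sup>2 + (norm (g n))\<^sup>2"
    using sum_squares_bound[of "norm (f n)" "norm (g n)"]
      mult_nonneg_nonneg[OF norm_ge_zero[of "f n"] norm_ge_zero[of "g n"]] by linarith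
  finally show "norm (inner (f n) (g n)) \<le> (norm (f n))\<^sup>2 + (norm (g n))\<^sup>2" .
qed

lemma summable_norm_sq_cinner:
  fixes f g :: "nat \<Rightarrow> 'a::complex_inner"
  assumes "summable (\<lambda>n. (norm (f n))\<^sup>2)" "summable (\<lambda>n. (norm (g n))\<^sup>2)"
  shows "summable (\<lambda>n. cinner (f n) (g n))"
  unfolding summable_complex_iff Im_cinner inner_eq_Re_cinner[symmetric]
  using assms by (auto intro!: summable_norm_sq_inner simp: norm_scaleC)

typedef (overloaded) 'a ell2 = "{f :: nat \<Rightarrow> 'a::complex_inner. summable (\<lambda>n. (norm (f n))\<^sup>2)}"
  morphisms ell2_nth Abs_ell2
  by (rule exI[of _ "\<lambda>_. 0"]) simp

setup_lifting type_definition_ell2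

lemma summable_ell2: "summable (\<lambda>n. (norm (ell2_nth f n))\<^sup>2)"
  using ell2_nth[of f] by simp

instantiation ell2 :: (complex_inner) real_vector
begin

lift_definition zero_ell2 :: "'a ell2" is "\<lambda>_. 0" by simp
lift_definition plus_ell2 :: "'a ell2 \<Rightarrow> 'a ell2 \<Rightarrow> 'a ell2" is "\<lambda>f g n. f n + g n"
  by (rule summable_norm_sq_add)
lift_definition uminus_ell2 :: "'a ell2 \<Rightarrow> 'a ell2" is "\<lambda>f n. - f n" by simp
lift_definition minus_ell2 :: "'a ell2 \<Rightarrow> 'a ell2 \<Rightarrow> 'a ell2" is "\<lambda>f g n. f n - g n"
  subgoal for f g using summable_norm_sq_add[of f "\<lambda>n. - g n"] by simp
  done
lift_definition scaleR_ell2 :: "real \<Rightarrow> 'a ell2 \<Rightarrow> 'a ell2" is "\<lambda>r f n. scaleR r (f n)"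
  by (simp add: power_mult_distrib summable_mult)

instance
  by (standard; transfer) (auto simp: fun_eq_iff algebra_simps scaleR_add_right scaleR_add_left)

end

instantiation ell2 :: (complex_inner) complex_inner
begin

lift_definition scaleC_ell2 :: "complex \<Rightarrow> 'a ell2 \<Rightarrow> 'a ell2" is "\<lambda>c f n. scaleC c (f n)"
  by (simp add: norm_scaleC power_mult_distrib summable_mult)
lift_definition cinner_ell2 :: "'a ell2 \<Rightarrow> 'a ell2 \<Rightarrow> complex"
  is "\<lambda>f g. \<Sum>n. cinner (f n) (g n)" .
definition inner_ell2 :: "'a ell2 \<Rightarrow> 'a ell2 \<Rightarrow> real"
  where "inner_ell2 f g = Re (cinner f g)"
definition norm_ell2 :: "'a ell2 \<Rightarrow> real"
  where "norm_ell2 f = sqrt (inner f f)"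
definition sgn_ell2 :: "'a ell2 \<Rightarrow> 'a ell2"
  where "sgn_ell2 f = scaleR (inverse (norm f)) f"
definition dist_ell2 :: "'a ell2 \<Rightarrow> 'a ell2 \<Rightarrow> real"
  where "dist_ell2 f g = norm (f - g)"
definition uniformity_ell2 :: "('a ell2 \<times> 'a ell2) filter"
  where "uniformity_ell2 = (INF e\<in>{0 <..}. principal {(x, y). dist x y < e})"
definition open_ell2 :: "'a ell2 set \<Rightarrow> bool"
  where "open_ell2 U \<longleftrightarrow> (\<forall>x\<in>U. eventually (\<lambda>(x', y). x' = x \<longrightarrow> y \<in> U) uniformity)"

instance
proof
  have summ: "summable (\<lambda>n. cinner (ell2_nth f n) (ell2_nth g n))" for f g :: "'a ell2"
    by (intro summable_norm_sq_cinner summable_ell2)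
  have sq: "inner f f = (\<Sum>n. (norm (ell2_nth f n))\<^sup>2)" for f :: "'a ell2"
    unfolding inner_ell2_def cinner_ell2.rep_eq
    by (simp add: Re_suminf[OF summ] power2_norm_eq_inner inner_eq_Re_cinner)
  fix f g h :: "'a ell2" and c d :: complex and r :: real
  show "dist f g = norm (f - g)" by (rule dist_ell2_def)
  show "sgn f = scaleR (inverse (norm f)) f" by (rule sgn_ell2_def)
  show "norm f = sqrt (inner f f)" by (rule norm_ell2_def)
  show "(uniformity :: ('a ell2 \<times> 'a ell2) filter)
      = (INF e\<in>{0 <..}. principal {(x, y). dist x y < e})" by (rule uniformity_ell2_def)
  show "open U \<longleftrightarrow> (\<forall>x\<in>U. eventually (\<lambda>(x', y). x' = x \<longrightarrow> y \<in> U) uniformity)"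
    for U :: "'a ell2 set" by (rule open_ell2_def)
  show "scaleC c (f + g) = scaleC c f + scaleC c g"
    by transfer (simp add: scaleC_add_right)
  show "scaleC (c + d) f = scaleC c f + scaleC d f"
    by transfer (simp add: scaleC_add_left)
  show "scaleC c (scaleC d f) = scaleC (c * d) f"
    by transfer (simp add: scaleC_scaleC)
  show RC: "scaleR r f = scaleC (complex_of_real r) f" for r and f :: "'a ell2"
    by transfer (simp add: scaleR_scaleC)
  have com: "cinner f g = cnj (cinner g f)" for f g :: "'a ell2"
  proof -
    have "(\<lambda>n. cnj (cinner (ell2_nth g n) (ell2_nth f n))) sums cnj (cinner g f)"
      unfolding cinner_ell2.rep_eq sums_cnj by (rule summable_sums[OF summ])
    then have "(\<lambda>n. cinner (ell2_nth f n) (ell2_nth g n)) sums cnj (cinner g f)"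
      by (subst cinner_commute)
    then show ?thesis
      unfolding cinner_ell2.rep_eq using sums_unique by metis
  qed
  show "cinner f g = cnj (cinner g f)" by (rule com)
  show add: "cinner (f + g) h = cinner f h + cinner g h" for f g h :: "'a ell2"
    unfolding cinner_ell2.rep_eq plus_ell2.rep_eq
    by (simp add: cinner_add_left suminf_add[OF summ summ])
  show sc: "cinner (scaleC c f) g = c * cinner f g" for c and f g :: "'a ell2"
    unfolding cinner_ell2.rep_eq scaleC_ell2.rep_eq
    by (simp add: cinner_scaleC_left suminf_mult[OF summ])
  show "inner f g = Re (cinner f g)" by (rule inner_ell2_def)
  show "inner f g = inner g f"
    unfolding inner_ell2_def by (subst com) simp
  show "inner (f + g) h = inner f h + inner g h"
    unfolding inner_ell2_def by (simp add: add)
  show "inner (scaleR r f) g = r * inner f g"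
    unfolding inner_ell2_def RC sc by simp
  show "0 \<le> inner f f"
    unfolding sq by (intro suminf_nonneg summable_ell2) simp
  have "inner f f = 0 \<longleftrightarrow> (\<forall>n. ell2_nth f n = 0)"
    unfolding sq by (subst suminf_eq_zero_iff[OF summable_ell2]) auto
  also have "\<dots> \<longleftrightarrow> f = 0"
    by transfer auto
  finally show "inner f f = 0 \<longleftrightarrow> f = 0" .
qed

end

lemma norm_ell2_sq: "(norm f)\<^sup>2 = (\<Sum>n. (norm (ell2_nth f n))\<^sup>2)"
proof -
  have "summable (\<lambda>n. cinner (ell2_nth f n) (ell2_nth f n))"
    by (intro summable_norm_sq_cinner summable_ell2)
  then show ?thesis
    unfolding power2_norm_eq_inner inner_eq_Re_cinner cinner_ell2.rep_eq
    by (simp add: Re_suminf)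
qed

lemma norm_ell2_nth_le: "norm (ell2_nth f n) \<le> norm f"
proof (rule power2_le_imp_le)
  show "(norm (ell2_nth f n))\<^sup>2 \<le> (norm f)\<^sup>2"
    unfolding norm_ell2_sq
    using sum_le_suminf[OF summable_ell2, of "{n}" f] by simp
qed simp

instance ell2 :: (chilbert_space) chilbert_space
proof
  fix X :: "nat \<Rightarrow> 'a ell2"
  assume X: "Cauchy X"
  have "Cauchy (\<lambda>m. ell2_nth (X m) k)" for k
  proof (rule CauchyI)
    fix e :: real assume "0 < e"
    then obtain N where N: "\<forall>m\<ge>N. \<forall>n\<ge>N. norm (X m - X n) < e"
      using CauchyD[OF X] by blast
    show "\<exists>N. \<forall>m\<ge>N. \<forall>n\<ge>N. norm (ell2_nth (X m) k - ell2_nth (X n) k) < e"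
      using N norm_ell2_nth_le[of "X _ - X _" k] unfolding minus_ell2.rep_eq
      by (meson order_le_less_trans)
  qed
  then obtain g where g: "\<And>k. (\<lambda>m. ell2_nth (X m) k) \<longlonglongrightarrow> g k"
    by (meson Cauchy_convergent convergent_def)
  have bound: "summable (\<lambda>k. (norm (ell2_nth (X m) k - g k))\<^sup>2)
      \<and> (\<Sum>k. (norm (ell2_nth (X m) k - g k))\<^sup>2) \<le> e\<^sup>2"
    if e: "\<And>n. n \<ge> N \<Longrightarrow> norm (X m - X n) < e" for m N e
  proof -
    have fin: "(\<Sum>k<K. (norm (ell2_nth (X m) k - g k))\<^sup>2) \<le> e\<^sup>2" for K
    proof (rule LIMSEQ_le_const2)
      show "(\<lambda>n. \<Sum>k<K. (norm (ell2_nth (X m) k - ell2_nth (X n) k))\<^sup>2)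
          \<longlonglongrightarrow> (\<Sum>k<K. (norm (ell2_nth (X m) k - g k))\<^sup>2)"
        by (intro tendsto_intros g)
      show "\<exists>N. \<forall>n\<ge>N. (\<Sum>k<K. (norm (ell2_nth (X m) k - ell2_nth (X n) k))\<^sup>2) \<le> e\<^sup>2"
      proof (intro exI allI impI)
        fix n assume "N \<le> n"
        have "(\<Sum>k<K. (norm (ell2_nth (X m - X n) k))\<^sup>2) \<le> (norm (X m - X n))\<^sup>2"
          unfolding norm_ell2_sq by (intro sum_le_suminf summable_ell2) auto
        also have "\<dots> \<le> e\<^sup>2"
          using e[OF \<open>N \<le> n\<close>] by (intro power_mono) auto
        finally show "(\<Sum>k<K. (norm (ell2_nth (X m) k - ell2_nth (X n) k))\<^sup>2) \<le> e\<^sup>2"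
          by (simp add: minus_ell2.rep_eq)
      qed
    qed
    have "summable (\<lambda>k. (norm (ell2_nth (X m) k - g k))\<^sup>2)"
      by (rule summableI_nonneg_bounded[OF _ fin]) simp
    then show ?thesis
      using suminf_le_const fin by blast
  qed
  obtain N1 where "\<forall>m\<ge>N1. \<forall>n\<ge>N1. norm (X m - X n) < 1"
    using CauchyD[OF X, of 1] by auto
  then have "summable (\<lambda>k. (norm (ell2_nth (X N1) k - g k))\<^sup>2)"
    using bound[of N1 N1 1] by auto
  then have "summable (\<lambda>k. (norm (- (ell2_nth (X N1) k - g k)))\<^sup>2)"
    by (simp only: norm_minus_cancel)
  from summable_norm_sq_add[OF this summable_ell2[of "X N1"]]
  have "summable (\<lambda>k. (norm (g k))\<^sup>2)" by simp
  then have nth: "ell2_nth (Abs_ell2 g) = g"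
    by (simp add: Abs_ell2_inverse)
  have "X \<longlonglongrightarrow> Abs_ell2 g"
  proof (rule LIMSEQ_I)
    fix e :: real assume "0 < e"
    then obtain N where N: "\<forall>m\<ge>N. \<forall>n\<ge>N. norm (X m - X n) < e / 2"
      using CauchyD[OF X, of "e / 2"] by auto
    show "\<exists>N. \<forall>m\<ge>N. norm (X m - Abs_ell2 g) < e"
    proof (intro exI allI impI)
      fix m assume "N \<le> m"
      with N have "(norm (X m - Abs_ell2 g))\<^sup>2 \<le> (e / 2)\<^sup>2"
        using bound[of N m "e / 2"] by (simp add: norm_ell2_sq minus_ell2.rep_eq nth)
      then have "norm (X m - Abs_ell2 g) \<le> e / 2"
        by (rule power2_le_imp_le) (use \<open>0 < e\<close> in simp)
      then show "norm (X m - Abs_ell2 g) < e" using \<open>0 < e\<close> by simp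
    qed
  qed
  then show "convergent X" by (auto simp: convergent_def)
qed

section \<open>Bounded operators\<close>

definition bounded_clinear :: "('a::complex_inner \<Rightarrow> 'b::complex_inner) \<Rightarrow> bool"
  where "bounded_clinear T \<longleftrightarrow> bounded_linear T \<and> (\<forall>c x. T (scaleC c x) = scaleC c (T x))"

definition cadjoint :: "('a::complex_inner \<Rightarrow> 'b::complex_inner) \<Rightarrow> 'b \<Rightarrow> 'a"
  where "cadjoint T = (THE S. \<forall>x y. cinner (T x) y = cinner x (S y))"

definition selfadjoint_op :: "('a::complex_inner \<Rightarrow> 'a) \<Rightarrow> bool"
  where "selfadjoint_op T \<longleftrightarrow> bounded_clinear T \<and> (\<forall>x y. cinner (T x) y = cinner x (T y))"

definition positive_op :: "('a::complex_inner \<Rightarrow> 'a) \<Rightarrow> bool"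
  where "positive_op T \<longleftrightarrow> selfadjoint_op T \<and> (\<forall>x. 0 \<le> Re (cinner (T x) x))"

definition op_sqrt :: "('a::complex_inner \<Rightarrow> 'a) \<Rightarrow> 'a \<Rightarrow> 'a"
  where "op_sqrt T = (THE S. positive_op S \<and> S \<circ> S = T)"

definition boundedly_invertible :: "('a::complex_inner \<Rightarrow> 'a) \<Rightarrow> bool"
  where "boundedly_invertible T \<longleftrightarrow> bij T \<and> bounded_clinear (inv T)"

definition isometric_embedding :: "('a::complex_inner \<Rightarrow> 'b::complex_inner) \<Rightarrow> bool"
  where "isometric_embedding V \<longleftrightarrow> bounded_clinear V \<and> (\<forall>x. norm (V x) = norm x)"

definition csubspace :: "'a::complex_inner set \<Rightarrow> bool"
  where "csubspace M \<longleftrightarrow>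
    0 \<in> M \<and> (\<forall>x\<in>M. \<forall>y\<in>M. x + y \<in> M) \<and> (\<forall>c. \<forall>x\<in>M. scaleC c x \<in> M)"

definition cspan :: "'a::complex_inner set \<Rightarrow> 'a set"
  where "cspan S = csubspace hull S"

definition orth_proj :: "'a::complex_inner set \<Rightarrow> 'a \<Rightarrow> 'a"
  where "orth_proj M x = (THE y. y \<in> M \<and> (\<forall>z\<in>M. cinner (x - y) z = 0))"

section \<open>Self-adjoint dilations\<close>

text \<open>
  The inclusion of \<open>\<H>\<close> in \<open>\<K>\<close> is an isometric embedding \<open>V\<close>, so that \<open>\<H>\<close> is identified
  with the closed subspace \<open>range V\<close>.
\<close>

definition selfadjoint_dilation ::
    "('h::chilbert_space \<Rightarrow> 'k::chilbert_space) \<Rightarrow> ('k \<Rightarrow> 'k) \<Rightarrow> (nat \<Rightarrow> 'h \<Rightarrow> 'h) \<Rightarrow> bool"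
  where "selfadjoint_dilation V C A \<longleftrightarrow>
    isometric_embedding V \<and> selfadjoint_op C \<and>
    (\<forall>n h. V (A n h) = orth_proj (range V) ((C ^^ n) (V h)))"

definition minimal_dilation ::
    "('h::chilbert_space \<Rightarrow> 'k::chilbert_space) \<Rightarrow> ('k \<Rightarrow> 'k) \<Rightarrow> (nat \<Rightarrow> 'h \<Rightarrow> 'h) \<Rightarrow> bool"
  where "minimal_dilation V C A \<longleftrightarrow>
    selfadjoint_dilation V C A \<and> closure (cspan {(C ^^ n) (V h) | n h. True}) = UNIV"

section \<open>The recurrence\<close>

text \<open>
  A tuple \<open>(r\<^sub>1, \<dots>, r\<^sub>m\<^sub>-\<^sub>1)\<close> is represented by the list \<open>w = [0, r\<^sub>1, \<dots>, r\<^sub>m\<^sub>-\<^sub>1, 0]\<close> of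
  length \<open>m + 1\<close>, so that \<open>w ! k\<close> is \<open>r\<^sub>k\<close>.
\<close>

definition walks :: "nat \<Rightarrow> nat list set"
  where "walks m = {w. length w = m + 1 \<and> w ! 0 = 0 \<and> w ! m = 0 \<and>
    (\<forall>k<m. \<bar>int (w ! k) - int (w ! Suc k)\<bar> \<le> 1)}"

fun walk_prod :: "(nat \<Rightarrow> nat \<Rightarrow> 'a \<Rightarrow> 'a) \<Rightarrow> nat list \<Rightarrow> 'a \<Rightarrow> 'a"
  where
    "walk_prod B (i # j # w) = B i j \<circ> walk_prod B (j # w)"
  | "walk_prod B [i] = id"
  | "walk_prod B [] = id"

primrec block_P :: "(nat \<Rightarrow> nat \<Rightarrow> 'a \<Rightarrow> 'a) \<Rightarrow> nat \<Rightarrow> 'a \<Rightarrow> 'a"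
  where
    "block_P B 0 = id"
  | "block_P B (Suc n) = B (Suc n) n \<circ> block_P B n"

definition block_F ::
    "(nat \<Rightarrow> 'a \<Rightarrow> 'a) \<Rightarrow> (nat \<Rightarrow> nat \<Rightarrow> 'a \<Rightarrow> 'a) \<Rightarrow> nat \<Rightarrow> 'a::complex_inner \<Rightarrow> 'a"
  where "block_F A B n =
    (\<lambda>x. A (2 * n) x - (\<Sum>w | w \<in> walks (2 * n) \<and> w ! n \<noteq> n. walk_prod B w x))"

definition block_E ::
    "(nat \<Rightarrow> 'a \<Rightarrow> 'a) \<Rightarrow> (nat \<Rightarrow> nat \<Rightarrow> 'a \<Rightarrow> 'a) \<Rightarrow> nat \<Rightarrow> 'a::complex_inner \<Rightarrow> 'a"
  where "block_E A B n =
    (\<lambda>x. A (2 * n + 1) x -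
      (\<Sum>w | w \<in> walks (2 * n + 1) \<and> (w ! n, w ! (n + 1)) \<noteq> (n, n). walk_prod B w x))"

definition radicand ::
    "(nat \<Rightarrow> 'a \<Rightarrow> 'a) \<Rightarrow> (nat \<Rightarrow> nat \<Rightarrow> 'a \<Rightarrow> 'a) \<Rightarrow> nat \<Rightarrow> 'a::complex_inner \<Rightarrow> 'a"
  where "radicand A B n =
    inv (cadjoint (block_P B (n - 1))) \<circ> block_F A B n \<circ> inv (block_P B (n - 1))"

definition block_recurrence ::
    "(nat \<Rightarrow> 'a \<Rightarrow> 'a) \<Rightarrow> (nat \<Rightarrow> nat \<Rightarrow> 'a::complex_inner \<Rightarrow> 'a) \<Rightarrow> bool"
  where "block_recurrence A B \<longleftrightarrow>
    (\<forall>i j. \<bar>int i - int j\<bar> > 1 \<longrightarrow> B i j = (\<lambda>x. 0)) \<and>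
    (\<forall>n\<ge>1. B (n - 1) n = cadjoint (B n (n - 1))) \<and>
    B 0 0 = A 1 \<and>
    (\<forall>n\<ge>1. B n (n - 1) = op_sqrt (radicand A B n)) \<and>
    (\<forall>n\<ge>1. B n n = inv (cadjoint (block_P B n)) \<circ> block_E A B n \<circ> inv (block_P B n))"

text \<open>
  Every sequence \<open>A\<close> has exactly one solution \<open>B\<close> (\<open>block_recurrence_ex1\<close>): \<open>block_F A B n\<close> involves only blocks with indices below
  \<open>n\<close>, and \<open>block_E A B n\<close> only blocks with indices at most \<open>n\<close> other than \<open>B n n\<close>.
\<close>

lemma walks_le:
  assumes "w \<in> walks m" "k \<le> m"
  shows "w ! k \<le> k" "w ! k \<le> m - k"
proof -
  from assms(1) have w: "w ! 0 = 0" "w ! m = 0" "\<And>k. k < m \<Longrightarrow> \<bar>int (w ! k) - int (w ! Suc k)\<bar> \<le> 1"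
    by (auto simp: walks_def)
  show "w ! k \<le> k"
    using assms(2)
  proof (induction k)
    case (Suc k)
    then show ?case using w(3)[of k] by auto
  qed (simp add: w)
  have "d \<le> m \<Longrightarrow> w ! (m - d) \<le> d" for d
  proof (induction d)
    case (Suc d)
    then have "Suc (m - Suc d) = m - d" by simp
    with Suc show ?case using w(3)[of "m - Suc d"] by auto
  qed (simp add: w)
  from this[of "m - k"] show "w ! k \<le> m - k" using assms(2) by simp
qed

lemma finite_walks: "finite (walks m)"
proof (rule finite_subset)
  show "walks m \<subseteq> {w. set w \<subseteq> {..m} \<and> length w = m + 1}"
  proof (intro subsetI CollectI conjI)
    fix w x assume w: "w \<in> walks m" and "x \<in> set w"
    then obtain k where "k < length w" "x = w ! k" by (metis in_set_conv_nth)
    then show "x \<in> {..m}" using walks_le(1)[OF w, of k] w by (auto simp: walks_def)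
  qed (auto simp: walks_def)
  show "finite {w. set w \<subseteq> {..m} \<and> length w = m + 1}"
    by (rule finite_lists_length_eq) simp
qed

lemma walk_prod_cong:
  assumes "\<And>k. Suc k < length w \<Longrightarrow> B (w ! k) (w ! Suc k) = B' (w ! k) (w ! Suc k)"
  shows "walk_prod B w = walk_prod B' w"
  using assms
proof (induction B w rule: walk_prod.induct)
  case (1 B i j w)
  have "walk_prod B (j # w) = walk_prod B' (j # w)"
  proof (rule "1.IH")
    fix k assume "Suc k < length (j # w)"
    then show "B ((j # w) ! k) ((j # w) ! Suc k) = B' ((j # w) ! k) ((j # w) ! Suc k)"
      using "1.prems"[of "Suc k"] by simp
  qed
  then show ?case using "1.prems"[of 0] by simp
qed auto

lemma block_P_cong:
  assumes "\<And>k. k < n \<Longrightarrow> B (Suc k) k = B' (Suc k) k"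
  shows "block_P B n = block_P B' n"
  using assms by (induction n) auto

lemma block_F_cong:
  assumes "\<And>i j. i < n \<Longrightarrow> j < n \<Longrightarrow> B i j = B' i j"
  shows "block_F A B n = block_F A B' n"
proof -
  have "walk_prod B w = walk_prod B' w" if w: "w \<in> walks (2 * n)" "w ! n \<noteq> n" for w
  proof -
    have lt: "w ! k < n" if "k \<le> 2 * n" for k
      using walks_le[OF w(1) that] w(2) that by (cases k n rule: linorder_cases) auto
    show ?thesis
    proof (rule walk_prod_cong)
      fix k assume "Suc k < length w"
      then have "Suc k \<le> 2 * n" using w(1) by (auto simp: walks_def)
      then show "B (w ! k) (w ! Suc k) = B' (w ! k) (w ! Suc k)"
        by (intro assms lt) auto
    qed
  qed
  then show ?thesis by (simp add: block_F_def cong: conj_cong)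
qed

lemma block_E_cong:
  assumes "\<And>i j. i \<le> n \<Longrightarrow> j \<le> n \<Longrightarrow> (i, j) \<noteq> (n, n) \<Longrightarrow> B i j = B' i j"
  shows "block_E A B n = block_E A B' n"
proof -
  have "walk_prod B w = walk_prod B' w"
    if w: "w \<in> walks (2 * n + 1)" "(w ! n, w ! (n + 1)) \<noteq> (n, n)" for w
  proof (rule walk_prod_cong)
    fix k assume "Suc k < length w"
    then have k: "k \<le> 2 * n + 1" "Suc k \<le> 2 * n + 1" using w(1) by (auto simp: walks_def)
    note le = walks_le[OF w(1) k(1)] walks_le[OF w(1) k(2)]
    show "B (w ! k) (w ! Suc k) = B' (w ! k) (w ! Suc k)"
    proof (rule assms)
      show "w ! k \<le> n" "w ! Suc k \<le> n" using le k by linarith+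
      show "(w ! k, w ! Suc k) \<noteq> (n, n)"
      proof
        assume eq: "(w ! k, w ! Suc k) = (n, n)"
        then have "k = n" using le k by simp
        with eq w(2) show False by simp
      qed
    qed
  qed
  then have "(\<Sum>w | w \<in> walks (2 * n + 1) \<and> (w ! n, w ! (n + 1)) \<noteq> (n, n). walk_prod B w x)
      = (\<Sum>w | w \<in> walks (2 * n + 1) \<and> (w ! n, w ! (n + 1)) \<noteq> (n, n). walk_prod B' w x)" for x
    by (intro sum.cong) auto
  then show ?thesis by (simp only: block_E_def)
qed

lemma radicand_cong:
  assumes "\<And>i j. i < n \<Longrightarrow> j < n \<Longrightarrow> B i j = B' i j"
  shows "radicand A B n = radicand A B' n"
  unfolding radicand_def
  using block_F_cong[of n B B' A, OF assms] block_P_cong[of "n - 1" B B'] assms by simp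

primrec block_stage ::
    "(nat \<Rightarrow> 'a \<Rightarrow> 'a) \<Rightarrow> nat \<Rightarrow> nat \<Rightarrow> nat \<Rightarrow> 'a::complex_inner \<Rightarrow> 'a"
  where
    "block_stage A 0 = (\<lambda>i j. if i = 0 \<and> j = 0 then A 1 else (\<lambda>x. 0))"
  | "block_stage A (Suc n) =
      (let S = op_sqrt (radicand A (block_stage A n) (Suc n));
           B = (\<lambda>i j. if i = Suc n \<and> j = n then S
             else if i = n \<and> j = Suc n then cadjoint S else block_stage A n i j)
       in (\<lambda>i j. if i = Suc n \<and> j = Suc n
            then inv (cadjoint (block_P B (Suc n))) \<circ> block_E A B (Suc n) \<circ> inv (block_P B (Suc n))
            else B i j))"

theorem block_recurrence_ex1: "\<exists>!B. block_recurrence A B"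
proof (rule ex_ex1I)
  define B where "B = (\<lambda>i j. block_stage A (max i j) i j)"
  have stage: "i \<le> n \<Longrightarrow> j \<le> n \<Longrightarrow> block_stage A n i j = B i j" for n i j
  proof (induction n)
    case (Suc n)
    show ?case
    proof (cases "i \<le> n \<and> j \<le> n")
      case True
      then show ?thesis using Suc.IH by (simp add: Let_def)
    next
      case False
      then have "max i j = Suc n" using Suc.prems by auto
      then show ?thesis by (simp add: B_def)
    qed
  qed (simp add: B_def)
  have zero: "\<bar>int i - int j\<bar> > 1 \<Longrightarrow> block_stage A n i j = (\<lambda>x. 0)" for n i j
    by (induction n) (auto simp: Let_def)
  have sub: "B (Suc n) n = op_sqrt (radicand A (block_stage A n) (Suc n))" for n
    by (simp add: B_def Let_def)
  have rad: "radicand A (block_stage A n) (Suc n) = radicand A B (Suc n)" for n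
    by (rule radicand_cong) (simp add: stage)
  have super: "B n (Suc n) = cadjoint (B (Suc n) n)" for n
    by (simp add: B_def Let_def)
  have diag: "B (Suc n) (Suc n) = inv (cadjoint (block_P B (Suc n))) \<circ> block_E A B (Suc n)
      \<circ> inv (block_P B (Suc n))" for n
  proof -
    define S where "S = op_sqrt (radicand A (block_stage A n) (Suc n))"
    define B' where "B' = (\<lambda>i j. if i = Suc n \<and> j = n then S
             else if i = n \<and> j = Suc n then cadjoint S else block_stage A n i j)"
    have "B (Suc n) (Suc n) = inv (cadjoint (block_P B' (Suc n))) \<circ> block_E A B' (Suc n)
      \<circ> inv (block_P B' (Suc n))"
      unfolding B'_def S_def by (simp add: B_def Let_def del: block_P.simps)
    moreover have eq: "B' i j = B i j"
      if "i \<le> Suc n" "j \<le> Suc n" "(i, j) \<noteq> (Suc n, Suc n)" for i j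
    proof -
      have "block_stage A (Suc n) i j = B' i j"
        using that by (auto simp: Let_def B'_def S_def)
      then show ?thesis using stage[OF that(1,2)] by simp
    qed
    have "block_E A B' (Suc n) = block_E A B (Suc n)"
      by (rule block_E_cong) (rule eq)
    moreover have "block_P B' (Suc n) = block_P B (Suc n)"
      by (rule block_P_cong) (rule eq, auto)
    ultimately show ?thesis by simp
  qed
  show "\<exists>B. block_recurrence A B"
  proof (intro exI[of _ B], unfold block_recurrence_def, intro conjI allI impI)
    show "\<bar>int i - int j\<bar> > 1 \<Longrightarrow> B i j = (\<lambda>x. 0)" for i j
      by (simp add: B_def zero)
    show "B 0 0 = A 1" by (simp add: B_def)
    fix n :: nat assume "1 \<le> n"
    then obtain m where n: "n = Suc m" by (cases n) auto
    show "B (n - 1) n = cadjoint (B n (n - 1))" using super n by simp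
    show "B n (n - 1) = op_sqrt (radicand A B n)" using sub rad n by simp
    show "B n n = inv (cadjoint (block_P B n)) \<circ> block_E A B n \<circ> inv (block_P B n)"
      using diag n by simp
  qed
next
  fix B B' assume B: "block_recurrence A B" and B': "block_recurrence A B'"
  have "\<forall>i\<le>n. \<forall>j\<le>n. B i j = B' i j" for n
  proof (induction n)
    case 0
    then show ?case using B B' by (simp add: block_recurrence_def)
  next
    case (Suc n)
    have "radicand A B (Suc n) = radicand A B' (Suc n)"
      by (rule radicand_cong) (use Suc in simp)
    then have sub: "B (Suc n) n = B' (Suc n) n"
      using B B' unfolding block_recurrence_def by (metis diff_Suc_1 le_add1 plus_1_eq_Suc)
    then have super: "B n (Suc n) = B' n (Suc n)"
      using B B' unfolding block_recurrence_def by (metis diff_Suc_1 le_add1 plus_1_eq_Suc)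
    have eq: "B i j = B' i j"
      if ij: "i \<le> Suc n" "j \<le> Suc n" "(i, j) \<noteq> (Suc n, Suc n)" for i j
    proof -
      consider "i \<le> n" "j \<le> n" | "i = Suc n" "j = n" | "i = n" "j = Suc n"
        | "\<bar>int i - int j\<bar> > 1"
        using ij by (fastforce simp: le_Suc_eq)
      then show ?thesis
      proof cases
        case 4
        then show ?thesis using B B' unfolding block_recurrence_def by metis
      qed (use Suc sub super in auto)
    qed
    have "block_E A B (Suc n) = block_E A B' (Suc n)"
      by (rule block_E_cong) (rule eq)
    moreover have "block_P B (Suc n) = block_P B' (Suc n)"
      by (rule block_P_cong) (rule eq, auto)
    ultimately have "B (Suc n) (Suc n) = B' (Suc n) (Suc n)"
      using B B' unfolding block_recurrence_def by (metis le_add1 plus_1_eq_Suc)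
    with eq show ?case by blast
  qed
  then show "B = B'" by (intro ext) (metis nat_le_linear)
qed

section \<open>Block matrices acting on square-summable sequences\<close>

definition block_row_sums :: "(nat \<Rightarrow> nat \<Rightarrow> 'a \<Rightarrow> 'a) \<Rightarrow> 'a::complex_inner ell2 \<Rightarrow> nat \<Rightarrow> 'a"
  where "block_row_sums B f i = (\<Sum>j. B i j (ell2_nth f j))"

definition block_op :: "(nat \<Rightarrow> nat \<Rightarrow> 'a \<Rightarrow> 'a) \<Rightarrow> 'a::complex_inner ell2 \<Rightarrow> 'a ell2"
  where "block_op B f = Abs_ell2 (block_row_sums B f)"

definition zeroth_summand :: "'a::complex_inner \<Rightarrow> 'a ell2"
  where "zeroth_summand h = Abs_ell2 (\<lambda>n. if n = 0 then h else 0)"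

end

theory Submission
  imports Defs
begin

text \<open>
  Let \<open>C\<close> be the given dilation and run the block Lanczos process on it: \<open>W\<^sub>0 = V\<close> and
  \<open>W\<^sub>n\<^sub>+\<^sub>1 = R\<^sub>n B\<^sub>(\<^sub>n\<^sub>+\<^sub>1\<^sub>)\<^sub>n\<^sup>-\<^sup>1\<close>, where \<open>R\<^sub>n\<close> is \<open>C W\<^sub>n\<close> with its components along \<open>W\<^sub>0, \<dots>, W\<^sub>n\<close> removed. Expanding
  \<open>C\<^sup>n V\<close> in the \<open>W\<^sub>j\<close>, whose coefficients are sums over walks, gives \<open>A\<^sub>2\<^sub>n\<close> and \<open>A\<^sub>2\<^sub>n\<^sub>+\<^sub>1\<close> as sums over walks
  plus the remainders \<open>P\<^sub>n\<^sub>-\<^sub>1\<^sup>* R\<^sub>n\<^sub>-\<^sub>1\<^sup>* R\<^sub>n\<^sub>-\<^sub>1 P\<^sub>n\<^sub>-\<^sub>1\<close> and \<open>P\<^sub>n\<^sup>* W\<^sub>n\<^sup>* C W\<^sub>n P\<^sub>n\<close>. These are \<open>F\<^sub>n\<close> and \<open>E\<^sub>n\<close>, so the radicands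
  are the positive operators \<open>R\<^sub>n\<^sub>-\<^sub>1\<^sup>* R\<^sub>n\<^sub>-\<^sub>1\<close>, the \<open>W\<^sub>n\<close> are isometries with orthogonal ranges, and
  \<open>B\<^sub>i\<^sub>j = W\<^sub>i\<^sup>* C W\<^sub>j\<close>. Hence the block matrix is \<open>C\<close> compressed to the span of the \<open>W\<^sub>n\<close>, an invariant subspace.
\<close>

instance chilbert_space \<subseteq> banach ..

section \<open>Complex structure versus the real inner product\<close>

lemma scaleC_zero [simp]: "scaleC c (0::'a::complex_inner) = 0"
  using scaleC_add_right[of c 0 "0::'a"] by simp

lemma scaleC_minus: "scaleC c (- x) = - scaleC c (x::'a::complex_inner)"
  using scaleC_add_right[of c x "- x"] by (simp add: eq_neg_iff_add_eq_0 add.commute)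

lemma scaleC_diff: "scaleC c (x - y) = scaleC c x - scaleC c (y::'a::complex_inner)"
  using scaleC_add_right[of c x "- y"] by (simp add: scaleC_minus)

lemma scaleC_sum: "scaleC c (sum f S) = (\<Sum>i\<in>S. scaleC c (f i :: 'a::complex_inner))"
  by (induction S rule: infinite_finite_induct) (simp_all add: scaleC_add_right)

text \<open>The real inner product and multiplication by \<open>- \<i>\<close> determine
  \<open>cinner\<close>. The later arguments therefore use \<open>inner\<close> and return to the
  complex form only through this identity.\<close>

lemma cinner_conv_inner:
  "cinner x y = Complex (inner x y) (inner (scaleC (- \<i>) x) (y::'a::complex_inner))"
  by (simp add: complex_eq_iff inner_eq_Re_cinner[symmetric] Im_cinner)

lemma inner_scaleC: "inner (scaleC c x) y = inner x (scaleC (cnj c) (y::'a::complex_inner))"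
proof -
  have "cinner x (scaleC (cnj c) y) = c * cinner x y"
    by (metis cinner_commute cinner_scaleC_left complex_cnj_cnj complex_cnj_mult)
  then show ?thesis by (simp add: inner_eq_Re_cinner cinner_scaleC_left)
qed

lemma inner_eqI: "(\<And>y. inner x y = inner z y) \<Longrightarrow> x = (z::'a::real_inner)"
  by (metis inner_commute vector_eq_ldot)

section \<open>Bounded complex-linear maps, adjoints and positivity\<close>

lemma bounded_clinear_compose:
  "bounded_clinear S \<Longrightarrow> bounded_clinear T \<Longrightarrow> bounded_clinear (S \<circ> T)"
  by (auto simp: bounded_clinear_def comp_def intro: bounded_linear_compose)

lemma bounded_clinear_id: "bounded_clinear id"
  by (simp add: bounded_clinear_def bounded_linear_ident id_def)

lemma bounded_clinear_diff:
  "bounded_clinear S \<Longrightarrow> bounded_clinear T \<Longrightarrow> bounded_clinear (\<lambda>x. S x - T x)"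
  by (auto simp: bounded_clinear_def scaleC_diff intro: bounded_linear_sub)

lemma bounded_clinear_sum:
  "(\<And>i. i \<in> I \<Longrightarrow> bounded_clinear (T i)) \<Longrightarrow> bounded_clinear (\<lambda>x. \<Sum>i\<in>I. T i x)"
  by (auto simp: bounded_clinear_def scaleC_sum intro!: bounded_linear_sum sum.cong)

text \<open>Linearity can be tested against all \<open>y\<close>. Boundedness comes from
  Cauchy-Schwarz at \<open>y = T x\<close>, after cancelling one factor \<open>norm (T x)\<close>.
  The criterion serves operators known only through their form, such as the blocks.\<close>

lemma bounded_clinear_sesquilinear:
  fixes T :: "'a::complex_inner \<Rightarrow> 'b::complex_inner" and X :: "'a \<Rightarrow> 'c::complex_inner"
  assumes X: "bounded_clinear X" and Y: "bounded_clinear Y"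
    and eq: "\<And>x y. inner (T x) y = inner (X x) (Y y)"
  shows "bounded_clinear T"
proof -
  have X': "bounded_linear X" and Y': "bounded_linear Y"
    using X Y by (simp_all add: bounded_clinear_def)
  obtain c where c: "\<And>x. norm (X x) \<le> norm x * c" "0 \<le> c"
    using bounded_linear.nonneg_bounded[OF X'] by blast
  obtain d where d: "\<And>x. norm (Y x) \<le> norm x * d" "0 \<le> d"
    using bounded_linear.nonneg_bounded[OF Y'] by blast
  have "bounded_linear T"
  proof (rule bounded_linear_intro)
    show "T (x + y) = T x + T y" for x y
      by (rule inner_eqI) (simp add: eq inner_add_left bounded_linear.linear[OF X', THEN linear_add])
    show "T (r *\<^sub>R x) = r *\<^sub>R T x" for r x
      by (rule inner_eqI) (simp add: eq bounded_linear.linear[OF X', THEN linear_scale])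
    show "norm (T x) \<le> norm x * (c * d)" for x
    proof -
      have "norm (T x) * norm (T x) \<le> norm (X x) * norm (Y (T x))"
        using Cauchy_Schwarz_ineq2[of "X x" "Y (T x)"] eq[of x "T x"]
        by (simp add: power2_norm_eq_inner[symmetric] power2_eq_square)
      also have "\<dots> \<le> (norm x * c) * (norm (T x) * d)"
        by (intro mult_mono c d) (simp_all add: c d)
      finally have "norm (T x) * norm (T x) \<le> (norm x * (c * d)) * norm (T x)"
        by (simp add: mult_ac)
      then show ?thesis
        by (cases "norm (T x) = 0") (simp_all add: c d)
    qed
  qed
  moreover have "T (scaleC k x) = scaleC k (T x)" for k x
    by (rule inner_eqI) (use X Y in \<open>simp add: eq bounded_clinear_def inner_scaleC\<close>)
  ultimately show ?thesis by (simp add: bounded_clinear_def)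
qed

lemma cinner_eq_if_inner_eq:
  assumes "bounded_clinear T" "bounded_clinear X"
    and "\<And>x y. inner (T x) y = inner (X x) (S y)"
  shows "cinner (T x) y = cinner (X x) (S y)"
proof -
  have "scaleC k (T x) = T (scaleC k x)" "scaleC k (X x) = X (scaleC k x)" for k
    using assms(1,2) by (simp_all add: bounded_clinear_def)
  then show ?thesis by (simp add: cinner_conv_inner assms(3))
qed

lemma selfadjoint_op_iff:
  "selfadjoint_op T \<longleftrightarrow> bounded_clinear T \<and> (\<forall>x y. inner (T x) y = inner x (T y))"
  using cinner_eq_if_inner_eq[OF _ bounded_clinear_id, of T T]
  by (auto simp: selfadjoint_op_def inner_eq_Re_cinner)

lemma positive_op_iff:
  "positive_op T \<longleftrightarrow> bounded_clinear T \<and> (\<forall>x y. inner (T x) y = inner x (T y)) \<and> (\<forall>x. 0 \<le> inner (T x) x)"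
  by (auto simp: positive_op_def selfadjoint_op_iff inner_eq_Re_cinner)

text \<open>\<open>cadjoint\<close> is a definite description, so its value is found by exhibiting a
  map with the adjoint property. Uniqueness follows because inner products separate vectors.\<close>

lemma cadjoint_eqI:
  assumes "bounded_clinear T" "\<And>x y. inner (T x) y = inner x (S y)"
  shows "cadjoint T = S"
  unfolding cadjoint_def
proof (rule the_equality)
  show "\<forall>x y. cinner (T x) y = cinner x (S y)"
    using cinner_eq_if_inner_eq[OF assms(1) bounded_clinear_id] assms(2) by auto
  fix S' assume "\<forall>x y. cinner (T x) y = cinner x (S' y)"
  then have "inner x (S y) = inner x (S' y)" for x y
    by (metis assms(2) inner_eq_Re_cinner)
  then have "inner (S' y) x = inner (S y) x" for x y
    by (metis inner_commute)
  then show "S' = S" by (rule ext[OF inner_eqI])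
qed

text \<open>This is positivity of \<open>R^* R\<close>, phrased through its form so that no adjoint
  of \<open>R\<close> has to be formed.\<close>

lemma positive_op_gram:
  assumes "bounded_clinear R" "\<And>x y. inner (T x) y = inner (R x) (R y)"
  shows "positive_op T"
  unfolding positive_op_iff
proof (intro conjI allI)
  show "bounded_clinear T" by (rule bounded_clinear_sesquilinear[OF assms(1,1,2)])
  show "inner (T x) y = inner x (T y)" for x y
    by (metis assms(2) inner_commute)
  show "0 \<le> inner (T x) x" for x by (simp add: assms(2))
qed

section \<open>Projection onto the range of an isometry\<close>

lemma isometric_embedding_inner:
  assumes "isometric_embedding V"
  shows "inner (V x) (V y) = inner x y"
proof -
  have V: "linear V" "\<And>x. norm (V x) = norm x"
    using assms by (auto simp: isometric_embedding_def bounded_clinear_def bounded_linear.linear)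
  have "norm (V x + V y) = norm (x + y)"
    by (metis V linear_add)
  then show ?thesis
    by (simp add: dot_norm V(2))
qed

lemma inner_zero_if_minimal:
  fixes u v :: "'a::real_inner"
  assumes "\<And>t. (norm u)\<^sup>2 \<le> (norm (u - t *\<^sub>R v))\<^sup>2"
  shows "inner u v = 0"
proof (cases "v = 0")
  case False
  \<comment> \<open>The minimiser of the quadratic in \<open>t\<close>, that is, the coefficient of
    the projection of \<open>u\<close> onto the line through \<open>v\<close>.\<close>
  define t where "t = inner u v / inner v v"
  have pos: "0 < inner v v" using False by simp
  have "(norm (u - t *\<^sub>R v))\<^sup>2 = (norm u)\<^sup>2 - 2 * (t * inner u v) + t * (t * inner v v)"
    by (simp add: power2_norm_eq_inner inner_diff inner_commute algebra_simps)
  also have "t * inner v v = inner u v" using pos by (simp add: t_def)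
  finally have "t * inner u v \<le> 0" using assms[of t] by simp
  then have "(inner u v)\<^sup>2 \<le> 0"
    using pos by (simp add: t_def power2_eq_square divide_le_0_iff)
  then show ?thesis by simp
qed simp

text \<open>A minimising sequence is Cauchy by the parallelogram law. It is taken in the domain of
  the isometry, so completeness of \<open>'h\<close> supplies the limit and closedness of
  \<open>range V\<close> is never discussed.\<close>

lemma isometric_embedding_nearest_point:
  fixes V :: "'h::chilbert_space \<Rightarrow> 'k::chilbert_space"
  assumes "isometric_embedding V"
  obtains x where "\<And>y. norm (k - V x) \<le> norm (k - V y)"
proof -
  have lin: "linear V" and nV: "\<And>x. norm (V x) = norm x" and cont: "\<And>x. isCont V x"
    using assms by (auto simp: isometric_embedding_def bounded_clinear_def bounded_linear.linear
        linear_continuous_at)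
  define d where "d = Inf (range (\<lambda>x. (norm (k - V x))\<^sup>2))"
  have bdd: "bdd_below (range (\<lambda>x. (norm (k - V x))\<^sup>2))"
    by (rule bdd_belowI[of _ 0]) auto
  have d: "d \<le> (norm (k - V x))\<^sup>2" for x
    unfolding d_def by (rule cInf_lower) (auto intro: bdd)
  have "\<exists>x. (norm (k - V x))\<^sup>2 < d + inverse (real (Suc n))" for n
    using cInf_lessD[of "range (\<lambda>x. (norm (k - V x))\<^sup>2)" "d + inverse (real (Suc n))"]
    unfolding d_def[symmetric] by auto
  then obtain X where X: "\<And>n. (norm (k - V (X n)))\<^sup>2 < d + inverse (real (Suc n))"
    by metis
  \<comment> \<open>Half the sum of the two residuals is the residual of the midpoint, whose squared
    norm is at least \<open>d\<close>.\<close>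
  have par: "(norm (x - y))\<^sup>2 \<le> 2 * (norm (k - V x))\<^sup>2 + 2 * (norm (k - V y))\<^sup>2 - 4 * d" for x y
  proof -
    let ?a = "k - V x" and ?b = "k - V y"
    have "?a - ?b = V (y - x)" by (simp add: linear_diff[OF lin])
    then have "norm (x - y) = norm (?a - ?b)" by (simp add: nV norm_minus_commute)
    then have "(norm (x - y))\<^sup>2 = 2 * (norm ?a)\<^sup>2 + 2 * (norm ?b)\<^sup>2 - (norm (?a + ?b))\<^sup>2"
      by (simp add: power2_norm_eq_inner inner_add inner_diff inner_commute algebra_simps)
    moreover have "?a + ?b = 2 *\<^sub>R (k - V ((1/2) *\<^sub>R (x + y)))"
      by (simp add: linear_scale[OF lin] linear_add[OF lin] scaleR_diff_right scaleR_add_right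
          scaleR_2)
    then have "(norm (?a + ?b))\<^sup>2 = 4 * (norm (k - V ((1/2) *\<^sub>R (x + y))))\<^sup>2"
      by (simp add: power_mult_distrib)
    ultimately show ?thesis using d[of "(1/2) *\<^sub>R (x + y)"] by linarith
  qed
  have "Cauchy X"
  proof (rule CauchyI)
    fix e :: real assume "0 < e"
    then obtain N where N: "inverse (real (Suc N)) < e\<^sup>2 / 4"
      using reals_Archimedean[of "e\<^sup>2 / 4"] by auto
    have near: "(norm (k - V (X n)))\<^sup>2 < d + e\<^sup>2 / 4" if "N \<le> n" for n
    proof -
      have "inverse (real (Suc n)) \<le> inverse (real (Suc N))" using that by simp
      then show ?thesis using X[of n] N by linarith
    qed
    show "\<exists>N. \<forall>m\<ge>N. \<forall>n\<ge>N. norm (X m - X n) < e"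
    proof (intro exI allI impI)
      fix m n assume "N \<le> m" "N \<le> n"
      then have "(norm (X m - X n))\<^sup>2 < e\<^sup>2"
        using par[of "X m" "X n"] near[of m] near[of n] by linarith
      then show "norm (X m - X n) < e"
        by (rule power_less_imp_less_base) (use \<open>0 < e\<close> in simp)
    qed
  qed
  then obtain x where x: "X \<longlonglongrightarrow> x"
    by (auto simp: Cauchy_convergent_iff convergent_def)
  have "(\<lambda>n. (norm (k - V (X n)))\<^sup>2) \<longlonglongrightarrow> (norm (k - V x))\<^sup>2"
    by (intro tendsto_intros isCont_tendsto_compose[OF cont] x)
  moreover have "(\<lambda>n. d + inverse (real (Suc n))) \<longlonglongrightarrow> d + 0"
    by (intro tendsto_intros LIMSEQ_inverse_real_of_nat)
  ultimately have le: "(norm (k - V x))\<^sup>2 \<le> d"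
    using LIMSEQ_le[of "\<lambda>n. (norm (k - V (X n)))\<^sup>2" _ "\<lambda>n. d + inverse (real (Suc n))" "d + 0"] X
    by (auto intro: less_imp_le)
  show ?thesis
  proof (rule that[of x])
    show "norm (k - V x) \<le> norm (k - V y)" for y
      by (rule power2_le_imp_le) (use le d[of y] in linarith, simp)
  qed
qed

text \<open>Two candidates differ by a vector of \<open>M\<close> that is orthogonal to
  itself.\<close>

lemma orth_proj_eqI:
  assumes "y \<in> M" "\<And>z. z \<in> M \<Longrightarrow> cinner (x - y) z = 0"
    and diff: "\<And>u v. u \<in> M \<Longrightarrow> v \<in> M \<Longrightarrow> u - v \<in> M"
  shows "orth_proj M x = y"
  unfolding orth_proj_def
proof (rule the_equality)
  show "y \<in> M \<and> (\<forall>z\<in>M. cinner (x - y) z = 0)" using assms by blast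
  fix v assume v: "v \<in> M \<and> (\<forall>z\<in>M. cinner (x - v) z = 0)"
  have "inner (x - v) (v - y) = 0" "inner (x - y) (v - y) = 0"
    using v assms by (simp_all add: inner_eq_Re_cinner)
  then have "inner (v - y) (v - y) = 0" by (simp add: inner_diff_left)
  then show "v = y" by simp
qed

text \<open>The nearest point is the orthogonal projection. This removes \<open>orth_proj\<close>
  from the dilation identity and leaves an identity between inner products.\<close>

lemma inner_orth_proj_range:
  fixes V :: "'h::chilbert_space \<Rightarrow> 'k::chilbert_space"
  assumes V: "isometric_embedding V"
  shows "inner (orth_proj (range V) k) (V y) = inner k (V y)"
proof -
  have cl: "bounded_clinear V" and lin: "linear V"
    using V by (auto simp: isometric_embedding_def bounded_clinear_def bounded_linear.linear)
  obtain x where x: "\<And>y. norm (k - V x) \<le> norm (k - V y)"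
    using isometric_embedding_nearest_point[OF V, of k] by blast
  have orth: "inner (k - V x) (V y) = 0" for y
  proof (rule inner_zero_if_minimal)
    fix t
    have "k - V x - t *\<^sub>R V y = k - V (x + t *\<^sub>R y)"
      by (simp add: linear_add[OF lin] linear_scale[OF lin])
    then show "(norm (k - V x))\<^sup>2 \<le> (norm (k - V x - t *\<^sub>R V y))\<^sup>2"
      by (metis x norm_ge_zero power_mono)
  qed
  \<comment> \<open>The range is closed under complex multiples, so real orthogonality to it already
    kills the imaginary part.\<close>
  have "inner (scaleC (- \<i>) (k - V x)) (V y) = 0" for y
    using orth[of "scaleC (cnj (- \<i>)) y"] cl by (simp add: inner_scaleC bounded_clinear_def)
  then have "cinner (k - V x) (V y) = 0" for y
    by (simp add: cinner_conv_inner orth complex_eq_iff)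
  then have "orth_proj (range V) k = V x"
    by (intro orth_proj_eqI) (auto simp flip: linear_diff[OF lin])
  then show ?thesis using orth[of y] by (simp add: inner_diff_left)
qed

section \<open>The positive square root\<close>

text \<open>\<open>1 - Y\<close> is a square root of \<open>1 - X\<close>. The iteration \<open>Y \<leftarrow> (X + Y\<^sup>2)/2\<close> from \<open>0\<close> is dominated in
  norm by the scalar iteration \<open>y \<leftarrow> (1 + y\<^sup>2)/2\<close>, which increases and stays below \<open>1\<close>.\<close>

lemma square_root_iteration:
  fixes X :: "'a::banach \<Rightarrow>\<^sub>L 'a"
  assumes X: "norm X \<le> 1"
  obtains Y where "norm Y \<le> 1" "2 *\<^sub>R Y = X + (Y o\<^sub>L Y)"
    "\<And>P. closed {Z. P Z} \<Longrightarrow> P 0 \<Longrightarrow> (\<And>Z. P Z \<Longrightarrow> P ((1/2) *\<^sub>R (X + (Z o\<^sub>L Z)))) \<Longrightarrow> P Y"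
proof -
  define Y where "Y n = ((\<lambda>Z. (1/2) *\<^sub>R (X + (Z o\<^sub>L Z))) ^^ n) 0" for n
  define y :: "nat \<Rightarrow> real" where "y n = ((\<lambda>z. (1 + z\<^sup>2) / 2) ^^ n) 0" for n
  have Y: "Y 0 = 0" "\<And>n. Y (Suc n) = (1/2) *\<^sub>R (X + (Y n o\<^sub>L Y n))" by (simp_all add: Y_def)
  have y: "y 0 = 0" "\<And>n. y (Suc n) = (1 + (y n)\<^sup>2) / 2" by (simp_all add: y_def)
  have bound: "0 \<le> y n \<and> y n \<le> 1 \<and> norm (Y n) \<le> y n" for n
  proof (induction n)
    case (Suc n)
    have "norm (Y n o\<^sub>L Y n) \<le> y n * y n"
      using norm_blinfun_compose[of "Y n" "Y n"] mult_mono[of "norm (Y n)" "y n" "norm (Y n)" "y n"] Suc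
      by simp
    then have "norm (Y (Suc n)) \<le> y (Suc n)"
      using norm_triangle_ineq[of X "Y n o\<^sub>L Y n"] X by (simp add: Y y power2_eq_square)
    moreover have "(y n)\<^sup>2 \<le> 1" using Suc by (simp add: abs_square_le_1)
    ultimately show ?case by (simp add: y)
  qed (simp add: Y y)
  have commX: "X o\<^sub>L Y n = Y n o\<^sub>L X" for n
  proof (induction n)
    case (Suc n)
    then have "blinfun_apply X (Y n z) = Y n (X z)" for z by (metis blinfun_apply_blinfun_compose)
    then show ?case
      by (intro blinfun_eqI) (simp add: Y blinfun.add_right blinfun.add_left blinfun.scaleR_right blinfun.scaleR_left)
  qed (intro blinfun_eqI, simp add: Y)
  have comm: "Y (Suc n) o\<^sub>L Y n = Y n o\<^sub>L Y (Suc n)" for n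
  proof -
    have "blinfun_apply X (Y n z) = Y n (X z)" for z by (metis commX blinfun_apply_blinfun_compose)
    then show ?thesis
      by (intro blinfun_eqI) (simp add: Y blinfun.add_right blinfun.add_left blinfun.scaleR_right blinfun.scaleR_left)
  qed
  \<comment> \<open>Consecutive iterates commute, so the difference of their squares factors as
    difference times sum. The scalar iteration factors in the same way and dominates it term by
    term.\<close>
  have step: "norm (Y (Suc n) - Y n) \<le> y (Suc n) - y n" for n
  proof (induction n)
    case 0
    show ?case using X by (simp add: Y y)
  next
    case (Suc n)
    let ?D = "Y (Suc n) - Y n" and ?S = "Y (Suc n) + Y n"
    have cz: "blinfun_apply (Y (Suc n)) (Y n z) = Y n (Y (Suc n) z)" for z
      by (metis comm blinfun_apply_blinfun_compose)
    have "Y (Suc (Suc n)) - Y (Suc n)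
        = (1/2) *\<^sub>R ((Y (Suc n) o\<^sub>L Y (Suc n)) - (Y n o\<^sub>L Y n))"
      using Y(2)[of "Suc n"] Y(2)[of n] by (simp add: scaleR_diff_right scaleR_add_right)
    also have "\<dots> = (1/2) *\<^sub>R (?D o\<^sub>L ?S)"
      by (intro blinfun_eqI) (simp add: blinfun.add_right blinfun.add_left blinfun.diff_left
          blinfun.diff_right blinfun.scaleR_left cz algebra_simps)
    finally have "norm (Y (Suc (Suc n)) - Y (Suc n)) = norm (?D o\<^sub>L ?S) / 2" by simp
    also have "\<dots> \<le> (norm ?D * norm ?S) / 2"
      using norm_blinfun_compose[of ?D ?S] by simp
    also have "\<dots> \<le> ((y (Suc n) - y n) * (y (Suc n) + y n)) / 2"
    proof -
      have "norm ?S \<le> y (Suc n) + y n"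
        using norm_triangle_ineq[of "Y (Suc n)" "Y n"] bound[of n] bound[of "Suc n"] by linarith
      moreover have "0 \<le> y (Suc n) - y n" using Suc norm_ge_zero order_trans by blast
      ultimately show ?thesis using Suc by (intro divide_right_mono mult_mono) auto
    qed
    also have "\<dots> = y (Suc (Suc n)) - y (Suc n)"
    proof -
      have "(q - r) * (q + r) / 2 = p - q" if "p = (1 + q\<^sup>2) / 2" "q = (1 + r\<^sup>2) / 2" for p q r :: real
      proof -
        have "p - q = (1 + q\<^sup>2) / 2 - (1 + r\<^sup>2) / 2"
          by (rule arg_cong2[where f = "(-)", OF that])
        then show ?thesis by (simp add: power2_eq_square field_simps)
      qed
      then show ?thesis using y(2)[of "Suc n"] y(2)[of n] by blast
    qed
    finally show ?case .
  qed
  \<comment> \<open>The dominating scalar increments telescope to \<open>y n\<close>, which is at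
    most 1.\<close>
  have "summable (\<lambda>n. norm (Y (Suc n) - Y n))"
  proof (rule summableI_nonneg_bounded[where x = 1])
    fix n
    have "(\<Sum>i<n. norm (Y (Suc i) - Y i)) \<le> (\<Sum>i<n. y (Suc i) - y i)"
      by (intro sum_mono step)
    also have "\<dots> \<le> 1" using bound[of n] by (simp add: sum_lessThan_telescope y(1))
    finally show "(\<Sum>i<n. norm (Y (Suc i) - Y i)) \<le> 1" .
  qed simp
  then have "summable (\<lambda>n. Y (Suc n) - Y n)" by (rule summable_norm_cancel)
  then have "convergent (\<lambda>n. \<Sum>i<n. Y (Suc i) - Y i)" by (simp add: summable_iff_convergent)
  moreover have "(\<Sum>i<n. Y (Suc i) - Y i) = Y n" for n by (simp add: sum_lessThan_telescope Y(1))
  ultimately obtain L where L: "Y \<longlonglongrightarrow> L" by (auto simp: convergent_def)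
  have "(\<lambda>n. Y (Suc n)) \<longlonglongrightarrow> (1/2) *\<^sub>R (X + (L o\<^sub>L L))"
    unfolding Y(2)
    by (intro tendsto_intros bounded_bilinear.tendsto[OF bounded_bilinear_blinfun_compose] L)
  then have fixpoint: "L = (1/2) *\<^sub>R (X + (L o\<^sub>L L))"
    using LIMSEQ_Suc[OF L] LIMSEQ_unique by blast
  show ?thesis
  proof (rule that[of L])
    show "norm L \<le> 1"
      by (rule LIMSEQ_le_const2[OF tendsto_norm[OF L]]) (use bound order_trans in blast)
    show "2 *\<^sub>R L = X + (L o\<^sub>L L)" by (subst fixpoint) simp
    \<comment> \<open>A closed property preserved by the iteration survives in the limit. Symmetry
      and commutation of the root are obtained from this principle.\<close>
    fix P :: "'a \<Rightarrow>\<^sub>L 'a \<Rightarrow> bool"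
    assume P: "closed {Z. P Z}" "P 0" "\<And>Z. P Z \<Longrightarrow> P ((1/2) *\<^sub>R (X + (Z o\<^sub>L Z)))"
    have "P (Y n)" for n by (induction n) (simp_all add: Y P)
    then show "P L"
      using closed_sequentially[OF P(1) _ L] by simp
  qed
qed

text \<open>In operator terms, \<open>T^2\<close> is at most \<open>T\<close> for a positive
  contraction. It follows from positivity of the form of \<open>T\<close> at
  \<open>x - T x\<close>.\<close>

lemma norm_positive_le:
  fixes T :: "'a::real_inner \<Rightarrow> 'a"
  assumes lin: "linear T" and sym: "\<And>x y. inner (T x) y = inner x (T y)"
    and pos: "\<And>x. 0 \<le> inner (T x) x" and le: "\<And>x. norm (T x) \<le> norm x"
  shows "(norm (T x))\<^sup>2 \<le> inner (T x) x"
proof -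
  have "inner (T (T x)) (T x) \<le> norm (T (T x)) * norm (T x)"
    by (rule norm_cauchy_schwarz)
  also have "\<dots> \<le> (norm (T x))\<^sup>2"
    using le[of "T x"] by (simp add: power2_eq_square mult_right_mono)
  finally have "inner (T (T x)) (T x) \<le> (norm (T x))\<^sup>2" .
  moreover have "inner (T (x - T x)) (x - T x)
      = inner (T x) x - 2 * (norm (T x))\<^sup>2 + inner (T (T x)) (T x)"
    by (simp add: linear_diff[OF lin] inner_diff power2_norm_eq_inner sym[of "T x" x])
  ultimately show ?thesis using pos[of "x - T x"] by linarith
qed

lemma positive_square_root_contraction:
  fixes T :: "'a::{real_inner,banach} \<Rightarrow> 'a"
  assumes bl: "bounded_linear T" and sym: "\<And>x y. inner (T x) y = inner x (T y)"
    and pos: "\<And>x. 0 \<le> inner (T x) x" and le: "\<And>x. norm (T x) \<le> norm x"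
  obtains S where "bounded_linear S" "\<And>x y. inner (S x) y = inner x (S y)"
    "\<And>x. 0 \<le> inner (S x) x" "\<And>x. S (S x) = T x"
    "\<And>G x. bounded_linear G \<Longrightarrow> (\<And>x. G (T x) = T (G x)) \<Longrightarrow> G (S x) = S (G x)"
proof -
  define X where "X = Blinfun (\<lambda>x. x - T x)"
  have Xa: "blinfun_apply X x = x - T x" for x
    unfolding X_def by (subst bounded_linear_Blinfun_apply) (auto intro: bounded_linear_sub bounded_linear_ident bl)
  \<comment> \<open>By \<open>norm_positive_le\<close>, the squared norm of \<open>x - T x\<close>
    is at most that of \<open>x\<close> minus that of \<open>T x\<close>. The triangle inequality
    alone would give only the bound 2.\<close>
  have "norm X \<le> 1"
  proof (rule norm_blinfun_bound)
    fix x
    have "(norm (x - T x))\<^sup>2 = (norm x)\<^sup>2 - 2 * inner (T x) x + (norm (T x))\<^sup>2"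
      by (simp add: power2_norm_eq_inner inner_diff inner_commute)
    also have "\<dots> \<le> (norm x)\<^sup>2"
      using norm_positive_le[OF bounded_linear.linear[OF bl] sym pos le, of x]
        zero_le_power2[of "norm (T x)"] by linarith
    finally have "norm (x - T x) \<le> norm x" by (rule power2_le_imp_le) simp
    then show "norm (blinfun_apply X x) \<le> 1 * norm x" by (simp add: Xa)
  qed simp
  then show ?thesis
  proof (rule square_root_iteration)
    fix Y assume Y: "norm Y \<le> 1" "2 *\<^sub>R Y = X + (Y o\<^sub>L Y)"
      and ind: "\<And>P. closed {Z. P Z} \<Longrightarrow> P 0 \<Longrightarrow> (\<And>Z. P Z \<Longrightarrow> P ((1/2) *\<^sub>R (X + (Z o\<^sub>L Z)))) \<Longrightarrow> P Y"
    have Yn: "norm (blinfun_apply Y x) \<le> norm x" for x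
      using norm_blinfun[of Y x] mult_right_mono[OF Y(1) norm_ge_zero[of x]] by linarith
    have capp: "continuous_on UNIV (\<lambda>Z. blinfun_apply Z z)" for z :: 'a
      by (intro continuous_intros)
    have symY: "inner (Y x) y = inner x (Y y)" for x y
    proof -
      have "\<forall>x y. inner (blinfun_apply Y x) y = inner x (Y y)"
      proof (rule ind)
        show "closed {Z. \<forall>x y. inner (blinfun_apply Z x) y = inner x (Z y)}"
          by (intro closed_Collect_all closed_Collect_eq continuous_intros)
        fix Z :: "'a \<Rightarrow>\<^sub>L 'a" assume "\<forall>x y. inner (blinfun_apply Z x) y = inner x (Z y)"
        then show "\<forall>x y. inner (blinfun_apply ((1/2) *\<^sub>R (X + (Z o\<^sub>L Z))) x) y
            = inner x (((1/2) *\<^sub>R (X + (Z o\<^sub>L Z))) y)"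
          by (simp add: Xa blinfun.add_left blinfun.scaleR_left inner_add inner_diff sym)
      qed simp
      then show ?thesis by blast
    qed
    have commY: "G (Y x) = Y (G x)" if G: "bounded_linear G" "\<And>x. G (T x) = T (G x)" for G x
    proof -
      have lin: "linear G" by (rule bounded_linear.linear[OF G(1)])
      have "\<forall>x. G (blinfun_apply Y x) = Y (G x)"
      proof (rule ind)
        have "continuous_on UNIV (\<lambda>Z :: 'a \<Rightarrow>\<^sub>L 'a. G (blinfun_apply Z x))" for x
          using bounded_linear.continuous_on[OF G(1) capp] .
        then show "closed {Z. \<forall>x. G (blinfun_apply Z x) = Z (G x)}"
          by (intro closed_Collect_all closed_Collect_eq capp)
        fix Z :: "'a \<Rightarrow>\<^sub>L 'a" assume "\<forall>x. G (blinfun_apply Z x) = Z (G x)"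
        then show "\<forall>x. G (blinfun_apply ((1/2) *\<^sub>R (X + (Z o\<^sub>L Z))) x)
            = ((1/2) *\<^sub>R (X + (Z o\<^sub>L Z))) (G x)"
          by (simp add: Xa blinfun.add_left blinfun.scaleR_left linear_add[OF lin] linear_diff[OF lin]
              linear_scale[OF lin] G(2))
      qed (simp add: linear_0[OF lin])
      then show ?thesis by blast
    qed
    show ?thesis
    proof (rule that[of "\<lambda>x. x - Y x"])
      show "bounded_linear (\<lambda>x. x - Y x)"
        by (intro bounded_linear_sub bounded_linear_ident blinfun.bounded_linear_right)
      show "inner (x - Y x) y = inner x (y - Y y)" for x y
        by (simp add: inner_diff symY)
      show "0 \<le> inner (x - Y x) x" for x
      proof -
        have "inner (Y x) x \<le> norm (Y x) * norm x" by (rule norm_cauchy_schwarz)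
        also have "\<dots> \<le> norm x * norm x" by (intro mult_right_mono Yn) simp
        finally show ?thesis by (simp add: inner_diff_left power2_norm_eq_inner[symmetric] power2_eq_square)
      qed
      show "x - Y x - Y (x - Y x) = T x" for x
      proof -
        have "2 *\<^sub>R Y x = x - T x + Y (Y x)"
          using arg_cong[OF Y(2), of "\<lambda>Z. blinfun_apply Z x"]
          by (simp add: Xa blinfun.add_left blinfun.scaleR_left)
        then show ?thesis by (simp add: blinfun.diff_right scaleR_2 algebra_simps)
      qed
      show "G (x - Y x) = G x - Y (G x)"
        if "bounded_linear G" "\<And>x. G (T x) = T (G x)" for G x
        using commY[OF that] by (simp add: linear_diff[OF bounded_linear.linear[OF that(1)]])
    qed
  qed
qed

text \<open>Dividing by a norm bound \<open>c\<close> reduces to a contraction; its root is rescaled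
  by \<open>sqrt c\<close>.\<close>

lemma positive_square_root:
  fixes T :: "'a::{real_inner,banach} \<Rightarrow> 'a"
  assumes bl: "bounded_linear T" and sym: "\<And>x y. inner (T x) y = inner x (T y)"
    and pos: "\<And>x. 0 \<le> inner (T x) x"
  obtains S where "bounded_linear S" "\<And>x y. inner (S x) y = inner x (S y)"
    "\<And>x. 0 \<le> inner (S x) x" "\<And>x. S (S x) = T x"
    "\<And>G x. bounded_linear G \<Longrightarrow> (\<And>x. G (T x) = T (G x)) \<Longrightarrow> G (S x) = S (G x)"
proof -
  obtain c where c: "0 < c" "\<And>x. norm (T x) \<le> norm x * c"
    using bounded_linear.pos_bounded[OF bl] by blast
  define T' where "T' x = (1 / c) *\<^sub>R T x" for x
  have 1: "bounded_linear T'" unfolding T'_def by (intro bounded_linear_const_scaleR bl)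
  have 2: "inner (T' x) y = inner x (T' y)" "0 \<le> inner (T' x) x" for x y
    using c sym pos by (simp_all add: T'_def)
  have 3: "norm (T' x) \<le> norm x" for x
    using c by (simp add: T'_def field_simps)
  from positive_square_root_contraction[OF 1 2 3]
  obtain S where S: "bounded_linear S" "\<And>x y. inner (S x) y = inner x (S y)"
    "\<And>x. 0 \<le> inner (S x) x" "\<And>x. S (S x) = T' x"
    "\<And>G x. bounded_linear G \<Longrightarrow> (\<And>x. G (T' x) = T' (G x)) \<Longrightarrow> G (S x) = S (G x)"
    by blast
  show ?thesis
  proof (rule that[of "\<lambda>x. sqrt c *\<^sub>R S x"])
    show "bounded_linear (\<lambda>x. sqrt c *\<^sub>R S x)" by (intro bounded_linear_const_scaleR S)
    show "inner (sqrt c *\<^sub>R S x) y = inner x (sqrt c *\<^sub>R S y)" for x y by (simp add: S)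
    show "0 \<le> inner (sqrt c *\<^sub>R S x) x" for x using c S by simp
    show "sqrt c *\<^sub>R S (sqrt c *\<^sub>R S x) = T x" for x
      using c by (simp add: linear_scale[OF bounded_linear.linear[OF S(1)]] S(4) T'_def)
    show "G (sqrt c *\<^sub>R S x) = sqrt c *\<^sub>R S (G x)"
      if G: "bounded_linear G" "\<And>x. G (T x) = T (G x)" for G x
    proof -
      have lin: "linear G" by (rule bounded_linear.linear[OF G(1)])
      have "G (S x) = S (G x)"
        by (rule S(5)[OF G(1)]) (simp add: T'_def linear_scale[OF lin] G(2))
      then show ?thesis by (simp add: linear_scale[OF lin])
    qed
  qed
qed

text \<open>Evaluated at \<open>z - t *\<^sub>R S z\<close>, the form has no constant term. A
  nonzero linear term would make it negative for small positive \<open>t\<close>.\<close>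

lemma positive_form_zero_imp_zero:
  fixes S :: "'a::real_inner \<Rightarrow> 'a"
  assumes lin: "linear S" and sym: "\<And>x y. inner (S x) y = inner x (S y)"
    and pos: "\<And>x. 0 \<le> inner (S x) x" and zero: "inner (S z) z = 0"
  shows "S z = 0"
proof -
  have nonneg: "0 \<le> t * (t * inner (S (S z)) (S z)) - 2 * (t * inner (S z) (S z))" for t
  proof -
    have "inner (S (z - t *\<^sub>R S z)) (z - t *\<^sub>R S z)
        = t * (t * inner (S (S z)) (S z)) - 2 * (t * inner (S z) (S z))"
      by (simp add: linear_diff[OF lin] linear_scale[OF lin] inner_diff sym[of "S z" z] zero
          algebra_simps)
    then show ?thesis using pos[of "z - t *\<^sub>R S z"] by simp
  qed
  define b where "b = inner (S (S z)) (S z)"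
  have b: "0 \<le> b" by (simp add: b_def pos)
  have nb: "0 \<le> t * (t * b - 2 * inner (S z) (S z))" for t
    using nonneg[of t] by (simp add: b_def algebra_simps)
  have "inner (S z) (S z) \<le> 0"
  proof (rule ccontr)
    assume "\<not> inner (S z) (S z) \<le> 0"
    then have s: "0 < inner (S z) (S z)" by linarith
    \<comment> \<open>Small enough that \<open>t * b\<close> is at most the squared norm of
      \<open>S z\<close>; adding 1 keeps the denominator positive.\<close>
    define t where "t = inner (S z) (S z) / (b + 1)"
    have t: "0 < t" using s b by (simp add: t_def)
    have "t * b \<le> inner (S z) (S z)"
      using s b by (simp add: t_def field_simps)
    then have "t * b - 2 * inner (S z) (S z) < 0" using s by linarith
    then have "t * (t * b - 2 * inner (S z) (S z)) < 0" by (rule mult_pos_neg[OF t])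
    then show False using nb[of t] by linarith
  qed
  then show ?thesis by (metis inner_eq_zero_iff inner_ge_zero order_antisym)
qed

text \<open>For \<open>z = S x - S' x\<close>, commutation and equality of the squares give
  \<open>S z + S' z = 0\<close>. Both forms then vanish at \<open>z\<close>, so \<open>S z\<close>
  and \<open>S' z\<close> are zero, and moving \<open>S - S'\<close> across shows that
  \<open>z\<close> is orthogonal to itself.\<close>

lemma positive_square_root_unique:
  fixes S S' :: "'a::real_inner \<Rightarrow> 'a"
  assumes S: "linear S" "\<And>x y. inner (S x) y = inner x (S y)" "\<And>x. 0 \<le> inner (S x) x"
    and S': "linear S'" "\<And>x y. inner (S' x) y = inner x (S' y)" "\<And>x. 0 \<le> inner (S' x) x"
    and comm: "\<And>x. S (S' x) = S' (S x)" and eq: "\<And>x. S (S x) = S' (S' x)"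
  shows "S = S'"
proof
  fix x
  define z where "z = S x - S' x"
  have "S z + S' z = 0"
    by (simp add: z_def linear_diff[OF S(1)] linear_diff[OF S'(1)] comm eq)
  then have "inner (S z) z + inner (S' z) z = 0"
    by (metis inner_add_left inner_zero_left)
  then have "inner (S z) z = 0" "inner (S' z) z = 0"
    using S(3)[of z] S'(3)[of z] by linarith+
  then have "S z = 0" "S' z = 0"
    using positive_form_zero_imp_zero[OF S] positive_form_zero_imp_zero[OF S'] by auto
  moreover have "inner z z = inner x (S z - S' z)"
    by (simp add: z_def inner_diff_right inner_diff_left S(2) S'(2) linear_diff[OF S(1)] linear_diff[OF S'(1)])
  ultimately show "S x = S' x" by (simp add: z_def)
qed

lemma op_sqrt_positive_op:
  fixes T :: "'a::chilbert_space \<Rightarrow> 'a"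
  assumes "positive_op T"
  shows "positive_op (op_sqrt T)" "op_sqrt T \<circ> op_sqrt T = T"
proof -
  have T: "bounded_linear T" "\<And>x y. inner (T x) y = inner x (T y)" "\<And>x. 0 \<le> inner (T x) x"
    and Tc: "\<And>c x. T (scaleC c x) = scaleC c (T x)"
    using assms by (auto simp: positive_op_iff bounded_clinear_def)
  obtain S where S: "bounded_linear S" "\<And>x y. inner (S x) y = inner x (S y)"
    "\<And>x. 0 \<le> inner (S x) x" "\<And>x. S (S x) = T x"
    "\<And>G x. bounded_linear G \<Longrightarrow> (\<And>x. G (T x) = T (G x)) \<Longrightarrow> G (S x) = S (G x)"
    using positive_square_root[OF T] by blast
  \<comment> \<open>The root is so far only real-linear; since complex scalars commute with
    \<open>T\<close>, they commute with \<open>S\<close>.\<close>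
  have "bounded_linear (scaleC c :: 'a \<Rightarrow> 'a)" for c
    by (rule bounded_linear_intro[of _ "cmod c"])
      (simp_all add: scaleC_add_right scaleR_scaleC scaleC_scaleC norm_scaleC mult_ac)
  then have "scaleC c (S x) = S (scaleC c x)" for c x
    by (rule S(5)) (simp add: Tc)
  then have posS: "positive_op S"
    using S by (simp add: positive_op_iff bounded_clinear_def)
  have "op_sqrt T = S"
    unfolding op_sqrt_def
  proof (rule the_equality)
    show "positive_op S \<and> S \<circ> S = T" using posS S(4) by auto
    fix S' assume "positive_op S' \<and> S' \<circ> S' = T"
    then have S': "bounded_linear S'" "\<And>x y. inner (S' x) y = inner x (S' y)"
      "\<And>x. 0 \<le> inner (S' x) x" "\<And>x. S' (S' x) = T x"
      by (auto simp: positive_op_iff bounded_clinear_def)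
    show "S' = S"
    proof (rule positive_square_root_unique)
      \<comment> \<open>Any other root \<open>S'\<close> commutes with its own square
        \<open>T\<close>, hence with \<open>S\<close>.\<close>
      show "S' (S x) = S (S' x)" for x by (rule S(5)[OF S'(1)]) (metis S'(4))
    qed (use S S' in \<open>auto simp: bounded_linear.linear\<close>)
  qed
  then show "positive_op (op_sqrt T)" "op_sqrt T \<circ> op_sqrt T = T"
    using posS S(4) by auto
qed

section \<open>Sums over walks\<close>

text \<open>The starting point is left free so that removing the first entry yields a recursion;
  \<open>walks m\<close> is the case \<open>i = 0\<close>.\<close>

definition walks_from :: "nat \<Rightarrow> nat \<Rightarrow> nat list set"
  where "walks_from m i = {w. length w = Suc m \<and> w ! 0 = i \<and> w ! m = 0 \<and>
    (\<forall>k<m. \<bar>int (w ! k) - int (w ! Suc k)\<bar> \<le> 1)}"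

lemma walks_from_0: "walks_from 0 i = (if i = 0 then {[0]} else {})"
  by (auto simp: walks_from_def length_Suc_conv)

lemma walks_from_Suc:
  "walks_from (Suc m) i = (\<Union>j\<in>{j. \<bar>int i - int j\<bar> \<le> 1}. (#) i ` walks_from m j)"
proof (intro equalityI subsetI)
  fix w assume w: "w \<in> walks_from (Suc m) i"
  then obtain v where v: "w = i # v" "length v = Suc m"
    by (auto simp: walks_from_def length_Suc_conv)
  have step: "\<bar>int (w ! k) - int (w ! Suc k)\<bar> \<le> 1" if "k < Suc m" for k
    using w that by (auto simp: walks_from_def)
  have "v \<in> walks_from m (v ! 0)"
    using w v step[of "Suc k" for k] by (auto simp: walks_from_def)
  moreover have "\<bar>int i - int (v ! 0)\<bar> \<le> 1" using step[of 0] v by simp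
  ultimately show "w \<in> (\<Union>j\<in>{j. \<bar>int i - int j\<bar> \<le> 1}. (#) i ` walks_from m j)"
    using v by blast
next
  fix w assume "w \<in> (\<Union>j\<in>{j. \<bar>int i - int j\<bar> \<le> 1}. (#) i ` walks_from m j)"
  then obtain j v where "\<bar>int i - int j\<bar> \<le> 1" "v \<in> walks_from m j" "w = i # v" by blast
  then show "w \<in> walks_from (Suc m) i"
    by (auto simp: walks_from_def less_Suc_eq_0_disj)
qed

lemma finite_neighbours: "finite {j. \<bar>int i - int j\<bar> \<le> 1}"
  by (rule finite_subset[of _ "{..Suc i}"]) auto

lemma finite_walks_from: "finite (walks_from m i)"
  by (induction m arbitrary: i) (simp_all add: walks_from_0 walks_from_Suc finite_neighbours)

text \<open>A tridiagonal row vanishes beyond column \<open>Suc i\<close>, so a finite sum suffices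
  and arbitrary sequences can be fed in without a convergence question.\<close>

definition tri_apply :: "(nat \<Rightarrow> nat \<Rightarrow> 'a \<Rightarrow> 'a) \<Rightarrow> (nat \<Rightarrow> 'a::real_vector) \<Rightarrow> nat \<Rightarrow> 'a"
  where "tri_apply B f i = (\<Sum>j\<le>Suc i. B i j (f j))"

definition single :: "nat \<Rightarrow> 'a::zero \<Rightarrow> nat \<Rightarrow> 'a"
  where "single k x i = (if i = k then x else 0)"

definition tridiagonal :: "(nat \<Rightarrow> nat \<Rightarrow> 'a \<Rightarrow> 'a::zero) \<Rightarrow> bool"
  where "tridiagonal B \<longleftrightarrow> (\<forall>i j. \<bar>int i - int j\<bar> > 1 \<longrightarrow> B i j = (\<lambda>x. 0))"

text \<open>The path expansion of a matrix power: splitting off the first step of each walk is one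
  application of the matrix.\<close>

lemma sum_walk_prod:
  fixes B :: "nat \<Rightarrow> nat \<Rightarrow> 'a \<Rightarrow> 'a::real_vector"
  assumes tri: "tridiagonal B" and lin: "\<And>i j. linear (B i j)"
  shows "(\<Sum>w\<in>walks_from m i. walk_prod B w x) = (tri_apply B ^^ m) (single 0 x) i"
proof (induction m arbitrary: i)
  case 0
  then show ?case by (simp add: walks_from_0 single_def)
next
  case (Suc m)
  have inj: "inj_on ((#) i) S" for S :: "nat list set" by simp
  have "(\<Sum>w\<in>walks_from (Suc m) i. walk_prod B w x)
      = (\<Sum>j | \<bar>int i - int j\<bar> \<le> 1. \<Sum>w\<in>(#) i ` walks_from m j. walk_prod B w x)"
    unfolding walks_from_Suc
  proof (rule sum.UNION_disjoint)
    show "\<forall>j\<in>{j. \<bar>int i - int j\<bar> \<le> 1}. \<forall>k\<in>{j. \<bar>int i - int j\<bar> \<le> 1}.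
        j \<noteq> k \<longrightarrow> (#) i ` walks_from m j \<inter> (#) i ` walks_from m k = {}"
      by (auto simp: walks_from_def)
  qed (simp_all add: finite_neighbours finite_walks_from)
  also have "\<dots> = (\<Sum>j | \<bar>int i - int j\<bar> \<le> 1. B i j (\<Sum>w\<in>walks_from m j. walk_prod B w x))"
  proof (rule sum.cong[OF refl])
    fix j
    have "walk_prod B (i # w) x = B i j (walk_prod B w x)" if "w \<in> walks_from m j" for w
      using that by (cases w) (auto simp: walks_from_def)
    then show "(\<Sum>w\<in>(#) i ` walks_from m j. walk_prod B w x)
        = B i j (\<Sum>w\<in>walks_from m j. walk_prod B w x)"
      by (simp add: sum.reindex[OF inj] linear_sum[OF lin])
  qed
  also have "\<dots> = (\<Sum>j\<le>Suc i. B i j ((tri_apply B ^^ m) (single 0 x) j))"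
    unfolding Suc
    by (rule sum.mono_neutral_left) (use tri in \<open>auto simp: tridiagonal_def\<close>)
  finally show ?case by (simp add: tri_apply_def[of B "(tri_apply B ^^ m) (single 0 x)"])
qed

lemma walk_prod_eq_0:
  fixes B :: "nat \<Rightarrow> nat \<Rightarrow> 'a \<Rightarrow> 'a::zero"
  assumes "Suc k < length w" "B (w ! k) (w ! Suc k) = (\<lambda>x. 0)" "\<And>i j. B i j 0 = 0"
  shows "walk_prod B w x = 0"
  using assms
proof (induction B w arbitrary: k rule: walk_prod.induct)
  case (1 B i j w)
  then show ?case by (cases k) auto
qed auto

lemma tri_apply_supported:
  fixes B :: "nat \<Rightarrow> nat \<Rightarrow> 'a \<Rightarrow> 'a::real_vector"
  assumes tri: "tridiagonal B" and supp: "\<And>j. N < j \<Longrightarrow> B i j = (\<lambda>x. 0)"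
  shows "tri_apply B f i = (\<Sum>j\<le>N. B i j (f j))"
proof -
  have "tri_apply B f i = (\<Sum>j\<le>max N (Suc i). B i j (f j))"
    unfolding tri_apply_def
    by (rule sum.mono_neutral_left) (use supp tri in \<open>auto simp: tridiagonal_def\<close>)
  also have "\<dots> = (\<Sum>j\<le>N. B i j (f j))"
    by (rule sum.mono_neutral_right) (use supp in auto)
  finally show ?thesis .
qed

text \<open>With zero columns beyond \<open>N\<close> this is a finite symmetric matrix, and its
  powers are moved across one factor at a time.\<close>

lemma tri_apply_symmetric:
  fixes B :: "nat \<Rightarrow> nat \<Rightarrow> 'a \<Rightarrow> 'a::real_inner"
  assumes tri: "tridiagonal B" and sym: "\<And>i j x y. inner (B i j x) y = inner x (B j i y)"
    and supp: "\<And>i j. N < j \<Longrightarrow> B i j = (\<lambda>x. 0)"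
  shows "(\<Sum>i\<le>N. inner ((tri_apply B ^^ k) f i) (g i)) = (\<Sum>i\<le>N. inner (f i) ((tri_apply B ^^ k) g i))"
proof (induction k arbitrary: g)
  case (Suc k)
  have "(\<Sum>i\<le>N. inner (tri_apply B f i) (g i)) = (\<Sum>i\<le>N. inner (f i) (tri_apply B g i))" for f g
  proof -
    have "(\<Sum>i\<le>N. inner (tri_apply B f i) (g i)) = (\<Sum>i\<le>N. \<Sum>j\<le>N. inner (f j) (B j i (g i)))"
      by (simp add: tri_apply_supported[OF tri supp] inner_sum_left sym)
    also have "\<dots> = (\<Sum>j\<le>N. \<Sum>i\<le>N. inner (f j) (B j i (g i)))" by (rule sum.swap)
    finally show ?thesis
      by (simp add: tri_apply_supported[OF tri supp] inner_sum_right)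
  qed
  from this[of "(tri_apply B ^^ k) f" g] Suc[of "tri_apply B g"]
  show ?case by (simp add: funpow_swap1)
qed simp

text \<open>Cutting closed walks after a fixed number of steps gives the matrix counterpart of
  \<open>moment_add\<close>. Comparing the two turns walk sums into statements about the
  dilation.\<close>

lemma inner_sum_walk_prod:
  fixes B :: "nat \<Rightarrow> nat \<Rightarrow> 'a \<Rightarrow> 'a::complex_inner"
  assumes tri: "tridiagonal B" and lin: "\<And>i j. linear (B i j)"
    and sym: "\<And>i j x y. inner (B i j x) y = inner x (B j i y)"
    and supp: "\<And>i j. N < j \<Longrightarrow> B i j = (\<lambda>x. 0)"
  shows "inner (\<Sum>w\<in>walks (m + k). walk_prod B w x) y
    = (\<Sum>i\<le>N. inner ((tri_apply B ^^ m) (single 0 x) i) ((tri_apply B ^^ k) (single 0 y) i))"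
proof -
  have walks: "walks (m + k) = walks_from (m + k) 0" by (simp add: walks_def walks_from_def)
  have "inner (\<Sum>w\<in>walks (m + k). walk_prod B w x) y
      = inner ((tri_apply B ^^ (k + m)) (single 0 x) 0) y"
    unfolding walks by (simp add: sum_walk_prod[OF tri lin] add.commute)
  also have "\<dots> = (\<Sum>i\<le>N. inner ((tri_apply B ^^ k) ((tri_apply B ^^ m) (single 0 x)) i) (single 0 y i))"
    by (simp add: funpow_add single_def if_distrib cong: if_cong)
  also have "\<dots> = (\<Sum>i\<le>N. inner ((tri_apply B ^^ m) (single 0 x) i) ((tri_apply B ^^ k) (single 0 y) i))"
    by (rule tri_apply_symmetric[OF tri sym supp])
  finally show ?thesis .
qed

section \<open>The block Lanczos process\<close>

text \<open>Writing \<open>x = P u\<close> and \<open>y = P v\<close> makes both inverses cancel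
  against \<open>P\<close> and its adjoint \<open>Q\<close>. This evaluates the conjugated
  expressions for radicands and diagonal blocks.\<close>

lemma inner_congruence:
  fixes P :: "'h::complex_inner \<Rightarrow> 'h"
  assumes P: "bounded_clinear P" "bij P" and Q: "bij Q" "\<And>x y. inner (P x) y = inner x (Q y)"
    and F: "\<And>x y. inner (F x) y = inner (X (P x)) (Y (P y))"
  shows "inner ((inv (cadjoint P) \<circ> F \<circ> inv P) x) y = inner (X x) (Y y)"
proof -
  have adj: "cadjoint P = Q" using P(1) Q(2) by (rule cadjoint_eqI)
  obtain u v where uv: "x = P u" "y = P v" using P(2) by (metis bij_pointE)
  have inv: "inv P x = u" unfolding uv by (rule inv_f_f[OF bij_is_inj[OF P(2)]])
  have "inner (P v) (inv Q (F u)) = inner v (F u)"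
    by (simp add: Q(2) surj_f_inv_f bij_is_surj[OF Q(1)])
  then have "inner (inv Q (F u)) (P v) = inner (F u) v" by (simp add: inner_commute)
  then show ?thesis using inv by (simp add: adj uv F)
qed

text \<open>The dilation identity enters in the weak form \<open>moment\<close>, with the projection
  already eliminated.\<close>

locale block_lanczos =
  fixes A :: "nat \<Rightarrow> 'h::chilbert_space \<Rightarrow> 'h"
    and B :: "nat \<Rightarrow> nat \<Rightarrow> 'h \<Rightarrow> 'h"
    and V :: "'h \<Rightarrow> 'k::chilbert_space"
    and C :: "'k \<Rightarrow> 'k"
  assumes V: "bounded_clinear V" and V_inner: "\<And>x y. inner (V x) (V y) = inner x y"
    and C: "selfadjoint_op C"
    and moment: "\<And>n x y. inner (A n x) y = inner ((C ^^ n) (V x)) (V y)"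
    and recurrence: "block_recurrence A B"
    and invertible: "\<And>n. boundedly_invertible (block_P B n)"
begin

text \<open>Built directly from the recursively given blocks. That these maps are isometries with
  orthogonal ranges is known only after the induction for \<open>invariant\<close>.\<close>

fun W :: "nat \<Rightarrow> 'h \<Rightarrow> 'k"
  where
    "W 0 = V"
  | "W (Suc n) = (\<lambda>x. let y = inv (B (Suc n) n) x in C (W n y) - (\<Sum>j\<le>n. W j (B j n y)))"

definition residual :: "nat \<Rightarrow> 'h \<Rightarrow> 'k"
  where "residual n y = C (W n y) - (\<Sum>j\<le>n. W j (B j n y))"

lemma C_symmetric: "inner (C x) y = inner x (C y)"
  and C_bounded_clinear: "bounded_clinear C" and C_linear: "linear C"
  using C by (auto simp: selfadjoint_op_iff bounded_clinear_def bounded_linear.linear)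

lemma C_pow_symmetric: "inner ((C ^^ n) x) y = inner x ((C ^^ n) y)"
  by (induction n arbitrary: x y) (simp_all add: C_symmetric funpow_swap1)

lemma moment_add: "inner (A (m + n) x) y = inner ((C ^^ m) (V x)) ((C ^^ n) (V y))"
  by (simp add: moment add.commute[of m n] funpow_add C_pow_symmetric[of n])

lemma tridiagonal_B: "tridiagonal B"
  using recurrence by (simp add: block_recurrence_def tridiagonal_def)

lemma B_zero: "\<bar>int i - int j\<bar> > 1 \<Longrightarrow> B i j = (\<lambda>x. 0)"
  using tridiagonal_B by (simp add: tridiagonal_def)

lemma B_0_0: "B 0 0 = A 1"
  and B_upper: "B n (Suc n) = cadjoint (B (Suc n) n)"
  and B_lower: "B (Suc n) n = op_sqrt (radicand A B (Suc n))"
  and B_diag: "B (Suc n) (Suc n) =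
    inv (cadjoint (block_P B (Suc n))) \<circ> block_E A B (Suc n) \<circ> inv (block_P B (Suc n))"
  using recurrence unfolding block_recurrence_def
  by (metis, metis diff_Suc_1 le_add1 plus_1_eq_Suc, metis diff_Suc_1 le_add1 plus_1_eq_Suc,
      metis le_add1 plus_1_eq_Suc)

lemma bij_P: "bij (block_P B n)"
  using invertible by (simp add: boundedly_invertible_def)

text \<open>The subdiagonal block is the quotient of two consecutive invertible products.\<close>

lemma bij_B_lower: "bij (B (Suc n) n)"
proof -
  have "B (Suc n) n = block_P B (Suc n) \<circ> inv (block_P B n)"
    using bij_P[of n] by (simp add: comp_assoc bij_is_surj surj_iff[THEN iffD1])
  then show ?thesis
    using bij_comp[OF bij_imp_bij_inv[OF bij_P[of n]] bij_P[of "Suc n"]] by simp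
qed

lemma W_residual: "W (Suc n) (B (Suc n) n y) = residual n y"
  by (simp add: residual_def bij_is_inj[OF bij_B_lower] Let_def)

text \<open>The block Lanczos recurrence. It holds by construction of \<open>W\<close>, before any
  orthogonality is available.\<close>

lemma C_W: "C (W n x) = (\<Sum>j\<le>Suc n. W j (B j n x))"
  using W_residual[of n x] by (simp add: residual_def del: W.simps)

text \<open>The walks left out of \<open>F\<^sub>n\<close> and \<open>E\<^sub>n\<close> are exactly those passing through a block that is not yet
  known. Setting these blocks to zero turns both restricted sums into sums over all walks.\<close>

definition block_cut :: "(nat \<times> nat) set \<Rightarrow> nat \<Rightarrow> nat \<Rightarrow> 'h \<Rightarrow> 'h"
  where "block_cut M i j = (if (i, j) \<in> M then B i j else (\<lambda>x. 0))"

lemma tridiagonal_cut: "tridiagonal (block_cut M)"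
  by (simp add: tridiagonal_def block_cut_def B_zero)

text \<open>By induction, the coordinates of \<open>C^k V x\<close> in the \<open>W i\<close> are
  the iterates of the cut matrix on the first unit vector. Passing from \<open>k\<close> to
  \<open>k + 1\<close> uses columns up to \<open>k < N\<close> only, so the possibly missing corner
  \<open>(N, N)\<close> is never met.\<close>

lemma krylov:
  assumes M: "\<And>i j. i \<le> N \<Longrightarrow> j \<le> N \<Longrightarrow> (i, j) \<noteq> (N, N) \<Longrightarrow> (i, j) \<in> M"
    and B0: "\<And>i j. (i, j) \<in> M \<Longrightarrow> B i j 0 = 0"
    and W: "\<And>i. i \<le> N \<Longrightarrow> linear (W i)"
    and k: "k \<le> N"
  shows "(\<forall>i>k. (tri_apply (block_cut M) ^^ k) (single 0 x) i = 0) \<and>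
    (tri_apply (block_cut M) ^^ k) (single 0 x) k = block_P B k x \<and>
    (\<Sum>i\<le>k. W i ((tri_apply (block_cut M) ^^ k) (single 0 x) i)) = (C ^^ k) (V x)"
  using k
proof (induction k)
  case 0
  then show ?case by (simp add: single_def)
next
  case (Suc k)
  define f where "f = (tri_apply (block_cut M) ^^ k) (single 0 x)"
  have f: "\<And>i. k < i \<Longrightarrow> f i = 0" "f k = block_P B k x" "(\<Sum>i\<le>k. W i (f i)) = (C ^^ k) (V x)"
    using Suc by (auto simp: f_def)
  have cut0: "block_cut M i j 0 = 0" for i j by (simp add: block_cut_def B0)
  have Tf: "tri_apply (block_cut M) f i = (\<Sum>j\<le>k. block_cut M i j (f j))" for i
  proof -
    have "(\<Sum>j\<le>Suc i. block_cut M i j (f j)) = (\<Sum>j\<le>max k (Suc i). block_cut M i j (f j))"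
      by (rule sum.mono_neutral_left)
        (use tridiagonal_cut[of M] in \<open>auto simp: tridiagonal_def\<close>)
    also have "\<dots> = (\<Sum>j\<le>k. block_cut M i j (f j))"
      by (rule sum.mono_neutral_right) (auto simp: f cut0)
    finally show ?thesis by (simp add: tri_apply_def)
  qed
  have far: "block_cut M i j = (\<lambda>x. 0)" if "Suc j < i" for i j
    using that by (simp add: block_cut_def B_zero)
  have "tri_apply (block_cut M) f i = 0" if "Suc k < i" for i
    unfolding Tf by (rule sum.neutral) (use that far in auto)
  moreover have "tri_apply (block_cut M) f (Suc k) = block_P B (Suc k) x"
  proof -
    have "tri_apply (block_cut M) f (Suc k) = (\<Sum>j\<in>{k}. block_cut M (Suc k) j (f j))"
      unfolding Tf by (rule sum.mono_neutral_right) (auto simp: far)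
    then show ?thesis using Suc.prems M[of "Suc k" k] by (simp add: block_cut_def f)
  qed
  moreover have "(\<Sum>i\<le>Suc k. W i (tri_apply (block_cut M) f i)) = (C ^^ Suc k) (V x)"
  proof -
    have "(\<Sum>i\<le>Suc k. W i (tri_apply (block_cut M) f i)) = (\<Sum>i\<le>Suc k. \<Sum>j\<le>k. W i (B i j (f j)))"
    proof (rule sum.cong[OF refl])
      fix i assume i: "i \<in> {..Suc k}"
      have "W i (tri_apply (block_cut M) f i) = (\<Sum>j\<le>k. W i (block_cut M i j (f j)))"
        unfolding Tf using i Suc.prems by (intro linear_sum W) auto
      also have "\<dots> = (\<Sum>j\<le>k. W i (B i j (f j)))"
        using i Suc.prems M by (intro sum.cong) (auto simp: block_cut_def)
      finally show "W i (tri_apply (block_cut M) f i) = (\<Sum>j\<le>k. W i (B i j (f j)))" .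
    qed
    also have "\<dots> = (\<Sum>j\<le>k. \<Sum>i\<le>Suc k. W i (B i j (f j)))" by (rule sum.swap)
    \<comment> \<open>For column \<open>j\<close> the recurrence \<open>C_W\<close> stops at row
      \<open>Suc j\<close>; the further rows up to \<open>Suc k\<close> carry zero blocks.\<close>
    also have "\<dots> = (\<Sum>j\<le>k. C (W j (f j)))"
    proof (rule sum.cong[OF refl])
      fix j assume j: "j \<in> {..k}"
      have "(\<Sum>i\<le>Suc j. W i (B i j (f j))) = (\<Sum>i\<le>Suc k. W i (B i j (f j)))"
        by (rule sum.mono_neutral_left) (use j Suc.prems W in \<open>auto simp: B_zero linear_0\<close>)
      then show "(\<Sum>i\<le>Suc k. W i (B i j (f j))) = C (W j (f j))" by (simp only: C_W)
    qed
    finally show ?thesis by (simp add: f(3)[symmetric] linear_sum[OF C_linear])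
  qed
  ultimately show ?case by (simp add: f_def)
qed

lemma inner_sum_W:
  assumes "\<And>i j x y. i \<le> n \<Longrightarrow> j \<le> n \<Longrightarrow> inner (W i x) (W j y) = (if i = j then inner x y else 0)"
  shows "inner (\<Sum>i\<le>n. W i (f i)) (\<Sum>i\<le>n. W i (g i)) = (\<Sum>i\<le>n. inner (f i) (g i))"
proof -
  have "inner (\<Sum>i\<le>n. W i (f i)) (\<Sum>i\<le>n. W i (g i)) = (\<Sum>i\<le>n. \<Sum>j\<le>n. inner (W j (f j)) (W i (g i)))"
    by (simp add: inner_sum_left inner_sum_right)
  also have "\<dots> = (\<Sum>i\<le>n. \<Sum>j\<le>n. if j = i then inner (f i) (g i) else 0)"
    by (intro sum.cong refl) (simp add: assms)
  finally show ?thesis by simp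
qed

section \<open>Form identities for the recurrence under partial orthonormality\<close>

definition orthonormal_upto :: "nat \<Rightarrow> bool"
  where "orthonormal_upto n \<longleftrightarrow> (\<forall>i\<le>n. bounded_clinear (W i)) \<and>
    (\<forall>i\<le>n. \<forall>j\<le>n. \<forall>x y. inner (W i x) (W j y) = (if i = j then inner x y else 0))"

text \<open>This is \<open>B i j = W_i^* C W_j\<close>, written without adjoints.\<close>

definition blocks_on :: "(nat \<times> nat) set \<Rightarrow> bool"
  where "blocks_on M \<longleftrightarrow> (\<forall>(i, j)\<in>M. \<forall>x y. inner (B i j x) y = inner (C (W j x)) (W i y))"

lemma orthonormal_uptoD:
  assumes "orthonormal_upto n"
  shows "i \<le> n \<Longrightarrow> bounded_clinear (W i)" "i \<le> n \<Longrightarrow> linear (W i)"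
    "i \<le> n \<Longrightarrow> j \<le> n \<Longrightarrow> inner (W i x) (W j y) = (if i = j then inner x y else 0)"
  using assms by (simp_all add: orthonormal_upto_def bounded_clinear_def bounded_linear.linear)

lemma blocks_onD:
  assumes "blocks_on M" "(i, j) \<in> M"
  shows "inner (B i j x) y = inner (C (W j x)) (W i y)"
  using assms unfolding blocks_on_def by fast

lemma blocks_on_symmetric:
  assumes "blocks_on M" "(i, j) \<in> M" "(j, i) \<in> M"
  shows "inner (B i j x) y = inner x (B j i y)"
  by (metis assms blocks_onD inner_commute C_symmetric)

lemma blocks_on_bounded_clinear:
  assumes "orthonormal_upto n" "blocks_on M" "M \<subseteq> {..n} \<times> {..n}" "(i, j) \<in> M"
  shows "bounded_clinear (B i j)"
proof (rule bounded_clinear_sesquilinear)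
  show "inner (B i j x) y = inner ((C \<circ> W j) x) (W i y)" for x y
    using blocks_onD[OF assms(2,4)] by simp
  show "bounded_clinear (C \<circ> W j)" "bounded_clinear (W i)"
    using assms by (auto intro!: bounded_clinear_compose C_bounded_clinear orthonormal_uptoD(1)[OF assms(1)])
qed

text \<open>By \<open>blocks_on\<close>, the subtracted coefficients are exactly the components of
  \<open>C (W n x)\<close>, so this is a Gram-Schmidt remainder.\<close>

lemma inner_residual_W:
  assumes orth: "orthonormal_upto n" and bl: "blocks_on ({..n} \<times> {..n})" and i: "i \<le> n"
  shows "inner (residual n x) (W i y) = 0"
proof -
  have "(\<Sum>j\<le>n. inner (W j (B j n x)) (W i y)) = (\<Sum>j\<le>n. if j = i then inner (B i n x) y else 0)"
    by (intro sum.cong refl) (use i in \<open>simp add: orthonormal_uptoD(3)[OF orth]\<close>)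
  then show ?thesis
    using i by (simp add: residual_def inner_diff_left inner_sum_left blocks_onD[OF bl])
qed

lemma inner_sum_walk_prod_cut:
  assumes orth: "orthonormal_upto n" and bl: "blocks_on M" and M: "M \<subseteq> {..n} \<times> {..n}" "sym M"
  shows "inner (\<Sum>w\<in>walks (m + k). walk_prod (block_cut M) w x) y
    = (\<Sum>i\<le>n. inner ((tri_apply (block_cut M) ^^ m) (single 0 x) i) ((tri_apply (block_cut M) ^^ k) (single 0 y) i))"
proof (rule inner_sum_walk_prod[OF tridiagonal_cut])
  show "linear (block_cut M i j)" for i j
    using blocks_on_bounded_clinear[OF orth bl M(1), of i j]
    by (auto simp: block_cut_def bounded_clinear_def bounded_linear.linear)
  show "inner (block_cut M i j x) y = inner x (block_cut M j i y)" for i j x y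
    using blocks_on_symmetric[OF bl] M(2) by (auto simp: block_cut_def sym_def)
  show "n < j \<Longrightarrow> block_cut M i j = (\<lambda>x. 0)" for i j
    using M(1) by (auto simp: block_cut_def)
qed

text \<open>The even moment is the inner product of two vectors \<open>C^(n+1) V x\<close>. Each is
  a part in the span of the \<open>W i\<close> plus an orthogonal residual. The parts in the span
  reproduce the walk sum subtracted in \<open>block_F\<close>, so only the residuals remain.\<close>

lemma block_F_form:
  assumes orth: "orthonormal_upto n" and bl: "blocks_on ({..n} \<times> {..n})"
  shows "inner (block_F A B (Suc n) x) y = inner (residual n (block_P B n x)) (residual n (block_P B n y))"
proof -
  define M where "M = {..n} \<times> {..n}"
  define t where "t k x = (tri_apply (block_cut M) ^^ k) (single 0 x)" for k x
  have bl': "blocks_on M" and M: "M \<subseteq> {..n} \<times> {..n}" "sym M"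
    using bl by (auto simp: M_def sym_def)
  have lin: "linear (B i j)" if "(i, j) \<in> M" for i j
    using blocks_on_bounded_clinear[OF orth bl' M(1) that] by (simp add: bounded_clinear_def bounded_linear.linear)
  have cut0: "block_cut M i j 0 = 0" for i j
    using lin[of i j] by (auto simp: block_cut_def linear_0)
  have F: "block_F A B (Suc n) x = A (2 * Suc n) x - (\<Sum>w\<in>walks (2 * Suc n). walk_prod (block_cut M) w x)" for x
  proof -
    have "block_F A B (Suc n) = block_F A (block_cut M) (Suc n)"
      by (rule block_F_cong) (auto simp: block_cut_def M_def)
    moreover have "(\<Sum>w | w \<in> walks (2 * Suc n) \<and> w ! Suc n \<noteq> Suc n. walk_prod (block_cut M) w x)
        = (\<Sum>w\<in>walks (2 * Suc n). walk_prod (block_cut M) w x)"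
    proof (rule sum.mono_neutral_left)
      show "\<forall>w\<in>walks (2 * Suc n) - {w \<in> walks (2 * Suc n). w ! Suc n \<noteq> Suc n}. walk_prod (block_cut M) w x = 0"
      proof
        fix w assume "w \<in> walks (2 * Suc n) - {w \<in> walks (2 * Suc n). w ! Suc n \<noteq> Suc n}"
        then have "length w = 2 * Suc n + 1" "w ! Suc n = Suc n" by (auto simp: walks_def)
        then show "walk_prod (block_cut M) w x = 0"
          by (intro walk_prod_eq_0[of "Suc n"] cut0) (auto simp: block_cut_def M_def)
      qed
    qed (auto simp: finite_walks)
    ultimately show ?thesis by (simp only: block_F_def)
  qed
  \<comment> \<open>One application of \<open>C\<close> beyond \<open>krylov\<close>: columns below
    \<open>n\<close> stay within the first \<open>n + 1\<close> maps, and only column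
    \<open>n\<close>, whose coefficient is \<open>block_P B n x\<close>, contributes a
    residual.\<close>
  have power: "(C ^^ Suc n) (V x) = (\<Sum>i\<le>n. W i (t (Suc n) x i)) + residual n (block_P B n x)" for x
  proof -
    have kry: "t n x n = block_P B n x" "(\<Sum>i\<le>n. W i (t n x i)) = (C ^^ n) (V x)"
      using krylov[of n M n x] lin orthonormal_uptoD(2)[OF orth] by (auto simp: t_def M_def linear_0)
    have CW: "C (W j z) = (\<Sum>i\<le>n. W i (B i j z)) + (if j = n then residual n z else 0)" if "j \<le> n" for j z
    proof (cases "j = n")
      case False
      have "(\<Sum>i\<le>Suc j. W i (B i j z)) = (\<Sum>i\<le>n. W i (B i j z))"
        by (rule sum.mono_neutral_left)
          (use False that orthonormal_uptoD(2)[OF orth] in \<open>auto simp: B_zero linear_0\<close>)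
      then show ?thesis using False by (simp only: C_W) simp
    qed (simp add: residual_def)
    have "tri_apply (block_cut M) (t n x) i = (\<Sum>j\<le>n. B i j (t n x j))" if "i \<le> n" for i
    proof -
      have "tri_apply (block_cut M) (t n x) i = (\<Sum>j\<le>n. block_cut M i j (t n x j))"
        by (rule tri_apply_supported[OF tridiagonal_cut]) (auto simp: block_cut_def M_def)
      then show ?thesis using that by (simp add: block_cut_def M_def)
    qed
    then have "W i (t (Suc n) x i) = (\<Sum>j\<le>n. W i (B i j (t n x j)))" if "i \<le> n" for i
      using that linear_sum[OF orthonormal_uptoD(2)[OF orth that]] by (simp add: t_def)
    then have "(\<Sum>i\<le>n. W i (t (Suc n) x i)) = (\<Sum>i\<le>n. \<Sum>j\<le>n. W i (B i j (t n x j)))" by simp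
    also have "\<dots> = (\<Sum>j\<le>n. \<Sum>i\<le>n. W i (B i j (t n x j)))" by (rule sum.swap)
    finally have "(\<Sum>i\<le>n. W i (t (Suc n) x i)) + residual n (t n x n) = (\<Sum>j\<le>n. C (W j (t n x j)))"
      by (simp add: CW sum.distrib)
    then show ?thesis by (simp add: kry(1) kry(2)[symmetric] linear_sum[OF C_linear])
  qed
  have perp: "inner (\<Sum>i\<le>n. W i (f i)) (residual n z) = 0" "inner (residual n z) (\<Sum>i\<le>n. W i (f i)) = 0" for f z
    by (simp_all add: inner_sum_left inner_sum_right inner_residual_W[OF orth bl] inner_commute[of "W _ _"])
  have "inner (A (2 * Suc n) x) y = (\<Sum>i\<le>n. inner (t (Suc n) x i) (t (Suc n) y i))
      + inner (residual n (block_P B n x)) (residual n (block_P B n y))"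
    unfolding mult_2 moment_add power
    by (simp add: inner_add perp inner_sum_W[OF orthonormal_uptoD(3)[OF orth]])
  then show ?thesis
    unfolding F mult_2 inner_diff_left inner_sum_walk_prod_cut[OF orth bl' M] by (simp add: t_def)
qed

text \<open>The odd moment places one \<open>C\<close> between two expansions of
  \<open>C^n V\<close>. Its matrix entries agree with the cut blocks except at the corner
  \<open>(n, n)\<close>. That entry meets the top coefficients \<open>block_P B n x\<close> and
  \<open>block_P B n y\<close> and is all that survives the subtraction.\<close>

lemma block_E_form:
  assumes orth: "orthonormal_upto n" and bl: "blocks_on ({..n} \<times> {..n} - {(n, n)})"
  shows "inner (block_E A B n x) y = inner (C (W n (block_P B n x))) (W n (block_P B n y))"
proof -
  define M where "M = {..n} \<times> {..n} - {(n, n)}"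
  define t where "t k x = (tri_apply (block_cut M) ^^ k) (single 0 x)" for k x
  have bl': "blocks_on M" and M: "M \<subseteq> {..n} \<times> {..n}" "sym M"
    using bl by (auto simp: M_def sym_def)
  have lin: "linear (B i j)" if "(i, j) \<in> M" for i j
    using blocks_on_bounded_clinear[OF orth bl' M(1) that] by (simp add: bounded_clinear_def bounded_linear.linear)
  have cut0: "block_cut M i j 0 = 0" for i j
    using lin[of i j] by (auto simp: block_cut_def linear_0)
  have E: "block_E A B n x = A (2 * n + 1) x - (\<Sum>w\<in>walks (2 * n + 1). walk_prod (block_cut M) w x)" for x
  proof -
    have "block_E A B n = block_E A (block_cut M) n"
      by (rule block_E_cong) (auto simp: block_cut_def M_def)
    moreover have "(\<Sum>w | w \<in> walks (2 * n + 1) \<and> (w ! n, w ! (n + 1)) \<noteq> (n, n). walk_prod (block_cut M) w x)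
        = (\<Sum>w\<in>walks (2 * n + 1). walk_prod (block_cut M) w x)"
    proof (rule sum.mono_neutral_left)
      show "\<forall>w\<in>walks (2 * n + 1) - {w \<in> walks (2 * n + 1). (w ! n, w ! (n + 1)) \<noteq> (n, n)}.
          walk_prod (block_cut M) w x = 0"
      proof
        fix w assume "w \<in> walks (2 * n + 1) - {w \<in> walks (2 * n + 1). (w ! n, w ! (n + 1)) \<noteq> (n, n)}"
        then have "length w = 2 * n + 2" "w ! n = n" "w ! Suc n = n" by (auto simp: walks_def)
        then show "walk_prod (block_cut M) w x = 0"
          by (intro walk_prod_eq_0[of n] cut0) (auto simp: block_cut_def M_def)
      qed
    qed (auto simp: finite_walks)
    ultimately show ?thesis by (simp only: block_E_def)
  qed
  have kry: "t n x n = block_P B n x" "(\<Sum>i\<le>n. W i (t n x i)) = (C ^^ n) (V x)" for x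
    using krylov[of n M n x] lin orthonormal_uptoD(2)[OF orth] by (auto simp: t_def M_def linear_0)
  let ?f = "t n x" and ?g = "t n y"
  have "inner (A (Suc n + n) x) y = inner (C (\<Sum>j\<le>n. W j (?f j))) (\<Sum>i\<le>n. W i (?g i))"
    unfolding moment_add kry by simp
  also have "\<dots> = (\<Sum>i\<le>n. \<Sum>j\<le>n. inner (C (W j (?f j))) (W i (?g i)))"
    by (simp add: linear_sum[OF C_linear] inner_sum_left inner_sum_right)
  also have "\<dots> = (\<Sum>i\<le>n. \<Sum>j\<le>n. inner (block_cut M i j (?f j)) (?g i) +
      (if j = n then if i = n then inner (C (W n (?f n))) (W n (?g n)) else 0 else 0))"
    by (intro sum.cong refl) (auto simp: block_cut_def M_def blocks_onD[OF bl])
  also have "\<dots> = (\<Sum>i\<le>n. inner (\<Sum>j\<le>n. block_cut M i j (?f j)) (?g i)) + inner (C (W n (?f n))) (W n (?g n))"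
    by (simp add: sum.distrib inner_sum_left)
  also have "(\<Sum>i\<le>n. inner (\<Sum>j\<le>n. block_cut M i j (?f j)) (?g i)) = (\<Sum>i\<le>n. inner (t (Suc n) x i) (?g i))"
  proof (intro sum.cong refl)
    fix i
    have "tri_apply (block_cut M) ?f i = (\<Sum>j\<le>n. block_cut M i j (?f j))"
      by (rule tri_apply_supported[OF tridiagonal_cut]) (auto simp: block_cut_def M_def)
    then show "inner (\<Sum>j\<le>n. block_cut M i j (?f j)) (?g i) = inner (t (Suc n) x i) (?g i)"
      by (simp add: t_def)
  qed
  finally have A: "inner (A (Suc n + n) x) y
      = (\<Sum>i\<le>n. inner (t (Suc n) x i) (?g i)) + inner (C (W n (?f n))) (W n (?g n))" .
  have "2 * n + 1 = Suc n + n" by simp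
  then show ?thesis
    unfolding E inner_diff_left
    using A inner_sum_walk_prod_cut[OF orth bl' M, where m = "Suc n" and k = n and x = x and y = y] kry(1) by (simp add: t_def mult_2)
qed

text \<open>Positivity of the radicands is carried along because \<open>op_sqrt\<close> is a
  definite description, shown to yield a root only for positive operators.\<close>

definition invariant :: "nat \<Rightarrow> bool"
  where "invariant n \<longleftrightarrow> orthonormal_upto n \<and> blocks_on ({..n} \<times> {..n}) \<and>
    (\<forall>k<n. positive_op (radicand A B (Suc k)))"

lemma B_lower_positive:
  assumes "positive_op (radicand A B (Suc k))"
  shows "positive_op (B (Suc k) k)" "B (Suc k) k (B (Suc k) k x) = radicand A B (Suc k) x"
    "B k (Suc k) = B (Suc k) k"
proof -
  show pos: "positive_op (B (Suc k) k)" by (simp add: B_lower op_sqrt_positive_op[OF assms])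
  show "B (Suc k) k (B (Suc k) k x) = radicand A B (Suc k) x"
    using fun_cong[OF op_sqrt_positive_op(2)[OF assms], of x] by (simp add: B_lower)
  show "B k (Suc k) = B (Suc k) k"
    unfolding B_upper using pos by (intro cadjoint_eqI) (auto simp: positive_op_iff)
qed

text \<open>The factors are self-adjoint bijections, so their product in reverse order is a
  bijective adjoint.\<close>

lemma block_P_adjoint:
  assumes "\<And>k. k < n \<Longrightarrow> positive_op (B (Suc k) k)"
  shows "bounded_clinear (block_P B n)"
    and "\<exists>Q. bij Q \<and> (\<forall>x y. inner (block_P B n x) y = inner x (Q y))"
proof -
  have "bounded_clinear (block_P B n) \<and> (\<exists>Q. bij Q \<and> (\<forall>x y. inner (block_P B n x) y = inner x (Q y)))"
    using assms
  proof (induction n)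
    case 0
    have "bounded_clinear (block_P B 0)" unfolding block_P.simps by (rule bounded_clinear_id)
    moreover have "\<exists>Q. bij Q \<and> (\<forall>x y. inner (block_P B 0 x) y = inner x (Q y))"
      by (rule exI[of _ id]) simp
    ultimately show ?case ..
  next
    case (Suc n)
    then obtain Q where Q: "bij Q" "\<And>x y. inner (block_P B n x) y = inner x (Q y)" by auto
    have S: "bounded_clinear (B (Suc n) n)" "\<And>x y. inner (B (Suc n) n x) y = inner x (B (Suc n) n y)"
      using Suc.prems by (auto simp: positive_op_iff)
    have "bij (Q \<circ> B (Suc n) n)" using bij_comp[OF bij_B_lower Q(1)] .
    moreover have "inner (block_P B (Suc n) x) y = inner x ((Q \<circ> B (Suc n) n) y)" for x y
      by (simp add: S(2) Q(2))
    moreover have "bounded_clinear (block_P B (Suc n))"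
      using Suc S(1) by (simp add: bounded_clinear_compose)
    ultimately show ?case by blast
  qed
  then show "bounded_clinear (block_P B n)"
    and "\<exists>Q. bij Q \<and> (\<forall>x y. inner (block_P B n x) y = inner x (Q y))" by auto
qed

lemma inner_block_P_congruence:
  assumes "\<And>k. k < n \<Longrightarrow> positive_op (B (Suc k) k)"
    and "\<And>x y. inner (F x) y = inner (X (block_P B n x)) (Y (block_P B n y))"
  shows "inner ((inv (cadjoint (block_P B n)) \<circ> F \<circ> inv (block_P B n)) x) y = inner (X x) (Y y)"
proof -
  obtain Q where "bij Q" "\<And>x y. inner (block_P B n x) y = inner x (Q y)"
    using block_P_adjoint(2)[OF assms(1)] by blast
  with block_P_adjoint(1)[OF assms(1)] bij_P assms(2) show ?thesis
    using inner_congruence[of "block_P B n" Q F X Y x y] by blast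
qed

lemma bounded_clinear_residual:
  assumes orth: "orthonormal_upto n" and bl: "blocks_on ({..n} \<times> {..n})"
  shows "bounded_clinear (residual n)"
proof -
  have "bounded_clinear (\<lambda>y. (C \<circ> W n) y - (\<Sum>j\<le>n. (W j \<circ> B j n) y))"
    by (intro bounded_clinear_diff bounded_clinear_sum bounded_clinear_compose C_bounded_clinear
        orthonormal_uptoD(1)[OF orth] blocks_on_bounded_clinear[OF orth bl]) auto
  then show ?thesis by (simp add: residual_def[abs_def] comp_def)
qed

lemma invariant_0: "invariant 0"
  by (auto simp: invariant_def orthonormal_upto_def blocks_on_def V V_inner B_0_0 moment)

text \<open>The order matters. \<open>block_F_form\<close> makes the new radicand positive, its root
  normalises the residual to \<open>W (Suc n)\<close>, orthonormality gives all new blocks but the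
  corner, and these are what \<open>block_E_form\<close> needs for the corner.\<close>

lemma invariant_Suc:
  assumes "invariant n"
  shows "invariant (Suc n)"
proof -
  have orth: "orthonormal_upto n" and bl: "blocks_on ({..n} \<times> {..n})"
    and rad: "\<And>k. k < n \<Longrightarrow> positive_op (radicand A B (Suc k))"
    using assms by (auto simp: invariant_def)
  let ?S = "B (Suc n) n"
  have radn: "inner (radicand A B (Suc n) x) y = inner (residual n x) (residual n y)" for x y
    unfolding radicand_def diff_Suc_1
    by (rule inner_block_P_congruence[where X = "residual n" and Y = "residual n"])
      (auto intro: B_lower_positive(1)[OF rad] block_F_form[OF orth bl])
  have "positive_op (radicand A B (Suc n))"
    by (rule positive_op_gram[OF bounded_clinear_residual[OF orth bl] radn])
  then have rad': "positive_op (radicand A B (Suc k))" if "k < Suc n" for k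
    using that rad by (cases "k = n") auto
  note lower = B_lower_positive[OF rad']
  have S: "bounded_clinear ?S" "\<And>x y. inner (?S x) y = inner x (?S y)"
    using lower(1)[of n] by (auto simp: positive_op_iff)
  obtain T where T: "\<And>x. ?S (T x) = x" "\<And>x. T (?S x) = x"
    using bij_B_lower[of n] by (metis bij_inv_eq_iff)
  have W: "W (Suc n) x = residual n (T x)" for x
    using W_residual[of n "T x"] by (simp add: T del: W.simps)
  \<comment> \<open>The radicand is the Gram operator of the residual, so dividing by its square
    root leaves an isometry, as in a polar decomposition.\<close>
  have W_W: "inner (W (Suc n) x) (W (Suc n) y) = inner x y" for x y
  proof -
    have "inner (residual n (T x)) (residual n (T y)) = inner (?S (?S (T x))) (T y)"
      using radn lower(2)[of n] by simp
    then show ?thesis unfolding W by (simp add: T S(2))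
  qed
  have W_perp: "inner (W (Suc n) x) (W i y) = 0" "inner (W i y) (W (Suc n) x) = 0" if "i \<le> n" for i x y
    unfolding W using inner_residual_W[OF orth bl that] by (simp_all add: inner_commute)
  \<comment> \<open>The inverse of the subdiagonal block is \<open>block_P B n\<close> after
    \<open>inv (block_P B (Suc n))\<close>; the assumed bounded inverse enters here.\<close>
  have T_bcl: "bounded_clinear T"
  proof (rule bounded_clinear_sesquilinear)
    have "boundedly_invertible (block_P B (Suc n))" by (rule invertible)
    then have "bounded_clinear (inv (block_P B (Suc n)))" by (simp add: boundedly_invertible_def)
    then show "bounded_clinear (block_P B n \<circ> inv (block_P B (Suc n)))"
      using block_P_adjoint(1)[OF B_lower_positive(1)[OF rad]] by (intro bounded_clinear_compose) auto
    show "bounded_clinear (id :: 'h \<Rightarrow> 'h)" by (rule bounded_clinear_id)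
    have "T x = block_P B n (inv (block_P B (Suc n)) x)" for x
    proof -
      have "?S (block_P B n (inv (block_P B (Suc n)) x)) = block_P B (Suc n) (inv (block_P B (Suc n)) x)"
        by simp
      also have "\<dots> = x" by (rule surj_f_inv_f[OF bij_is_surj[OF bij_P]])
      finally show ?thesis using T(2) by metis
    qed
    then show "inner (T x) y = inner ((block_P B n \<circ> inv (block_P B (Suc n))) x) (id y)" for x y
      by simp
  qed
  have "W (Suc n) = residual n \<circ> T" using W by auto
  then have W_bcl: "bounded_clinear (W (Suc n))"
    using bounded_clinear_compose[OF bounded_clinear_residual[OF orth bl] T_bcl] by metis
  have orth': "orthonormal_upto (Suc n)"
    unfolding orthonormal_upto_def
  proof (intro conjI allI impI)
    show "i \<le> Suc n \<Longrightarrow> bounded_clinear (W i)" for i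
      using W_bcl orthonormal_uptoD(1)[OF orth] by (metis le_Suc_eq)
    show "inner (W i x) (W j y) = (if i = j then inner x y else 0)" if "i \<le> Suc n" "j \<le> Suc n" for i j x y
    proof -
      consider "i \<le> n" "j \<le> n" | "i \<le> n" "j = Suc n" | "i = Suc n" "j \<le> n" | "i = Suc n" "j = Suc n"
        using \<open>i \<le> Suc n\<close> \<open>j \<le> Suc n\<close> by linarith
      then show ?thesis
        by cases (simp_all add: orthonormal_uptoD(3)[OF orth] W_W W_perp del: W.simps)
    qed
  qed
  \<comment> \<open>For \<open>j = n\<close> only the last term of \<open>C_W\<close> is not
    orthogonal to \<open>W (Suc n)\<close>. For smaller \<open>j\<close> the expansion stops earlier
    and the block is zero.\<close>
  have low: "inner (B (Suc n) j x) y = inner (C (W j x)) (W (Suc n) y)" if "j \<le> n" for j x y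
  proof -
    have "inner (C (W j x)) (W (Suc n) y)
        = (\<Sum>i\<le>Suc j. if i = Suc n then inner (B (Suc n) j x) y else 0)"
      unfolding C_W inner_sum_left
      using that by (intro sum.cong refl) (simp add: orthonormal_uptoD(3)[OF orth'] del: W.simps)
    then show ?thesis using that B_zero[of "Suc n" j] by (cases "j = n") (auto simp: le_neq_trans)
  qed
  have sym_B: "inner (B i (Suc n) x) y = inner x (B (Suc n) i y)" if "i \<le> n" for i x y
    using that B_zero[of "Suc n" i] B_zero[of i "Suc n"] lower(3)[of n] S(2)
    by (cases "i = n") auto
  have off: "blocks_on ({..Suc n} \<times> {..Suc n} - {(Suc n, Suc n)})"
    unfolding blocks_on_def
  proof (clarify)
    fix i j x y
    assume ij: "i \<le> Suc n" "j \<le> Suc n" "\<not> (i = Suc n \<and> j = Suc n)"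
    then consider "i \<le> n" "j \<le> n" | "i \<le> n" "j = Suc n" | "i = Suc n" "j \<le> n" by linarith
    then show "inner (B i j x) y = inner (C (W j x)) (W i y)"
    proof cases
      case 1
      then show ?thesis using blocks_onD[OF bl, of i j] by simp
    next
      case 2
      then show ?thesis
        using low[of i y x] sym_B[of i x y] by (metis inner_commute C_symmetric)
    next
      case 3
      then show ?thesis using low by simp
    qed
  qed
  \<comment> \<open>\<open>off\<close> covers every index pair except this corner, which is exactly
    the input of \<open>block_E_form\<close>.\<close>
  have "inner (B (Suc n) (Suc n) x) y = inner (C (W (Suc n) x)) (W (Suc n) y)" for x y
    unfolding B_diag
    by (rule inner_block_P_congruence[where X = "\<lambda>x. C (W (Suc n) x)" and Y = "W (Suc n)"])
      (auto intro: lower(1) block_E_form[OF orth' off] simp del: W.simps block_P.simps)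
  then have "blocks_on ({..Suc n} \<times> {..Suc n})"
    using off unfolding blocks_on_def by blast
  with orth' rad' show ?thesis by (simp add: invariant_def)
qed

section \<open>Orthonormality and block identities for all indices\<close>

lemma invariant: "invariant n"
  by (induction n) (use invariant_0 invariant_Suc in auto)

lemma W_bounded_clinear: "bounded_clinear (W n)"
  and W_linear: "linear (W n)"
  using invariant[of n] orthonormal_uptoD(1,2)[of n n] by (auto simp: invariant_def)

lemma W_inner: "inner (W i x) (W j y) = (if i = j then inner x y else 0)"
  using invariant[of "max i j"] orthonormal_uptoD(3)[of "max i j" i j] by (auto simp: invariant_def)

lemma B_form: "inner (B i j x) y = inner (C (W j x)) (W i y)"
  using invariant[of "max i j"] blocks_onD[of "{..max i j} \<times> {..max i j}" i j] by (auto simp: invariant_def)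

lemma radicand_positive: "positive_op (radicand A B (Suc n))"
  using invariant[of "Suc n"] by (simp add: invariant_def)

lemma B_bounded_clinear: "bounded_clinear (B i j)"
  by (rule bounded_clinear_sesquilinear[of "C \<circ> W j" "W i"])
    (simp_all add: B_form bounded_clinear_compose C_bounded_clinear W_bounded_clinear)

lemma B_0: "B i j 0 = 0"
  using B_bounded_clinear[of i j] by (simp add: bounded_clinear_def bounded_linear.linear linear_0)

end

section \<open>Square-summable sequences\<close>

lemma ell2_eqI: "(\<And>i. ell2_nth f i = ell2_nth g i) \<Longrightarrow> f = g"
  by (metis ell2_nth_inject ext)

lemma sums_inner_ell2: "(\<lambda>n. inner (ell2_nth f n) (ell2_nth g n)) sums inner f g"
proof -
  have "(\<lambda>n. cinner (ell2_nth f n) (ell2_nth g n)) sums cinner f g"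
    unfolding cinner_ell2.rep_eq by (intro summable_sums summable_norm_sq_cinner summable_ell2)
  then show ?thesis unfolding inner_ell2_def inner_eq_Re_cinner by (rule sums_Re)
qed

lemma ell2_nth_tendsto_0: "(\<lambda>n. norm (ell2_nth f n)) \<longlonglongrightarrow> 0"
  using tendsto_real_sqrt[OF summable_LIMSEQ_zero[OF summable_ell2[of f]]] by simp

lemma ell2_nth_sum: "ell2_nth (sum F S) i = (\<Sum>j\<in>S. ell2_nth (F j) i)"
  by (induction S rule: infinite_finite_induct) (simp_all add: zero_ell2.rep_eq plus_ell2.rep_eq)

definition summand :: "nat \<Rightarrow> 'a::complex_inner \<Rightarrow> 'a ell2"
  where "summand k x = Abs_ell2 (single k x)"

lemma ell2_nth_summand: "ell2_nth (summand k x) = single k x"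
proof -
  have "summable (\<lambda>n. (norm (single k x n))\<^sup>2)"
    by (rule summable_finite[of "{k}"]) (simp_all add: single_def)
  then show ?thesis by (simp add: summand_def Abs_ell2_inverse)
qed

lemma zeroth_summand_eq: "zeroth_summand = summand 0"
  by (simp add: zeroth_summand_def[abs_def] summand_def[abs_def] single_def[abs_def])

lemma inner_summand: "inner f (summand k x) = inner (ell2_nth f k) x"
proof -
  have "(\<lambda>n. inner (ell2_nth f n) (ell2_nth (summand k x) n)) sums (\<Sum>n\<in>{k}. inner (ell2_nth f n) (ell2_nth (summand k x) n))"
    by (rule sums_finite) (simp_all add: ell2_nth_summand single_def)
  then show ?thesis
    using sums_unique2[OF sums_inner_ell2[of f "summand k x"]] by (simp add: ell2_nth_summand single_def)
qed

lemma isometric_embedding_summand: "isometric_embedding (summand k)"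
proof -
  have norm: "norm (summand k x) = norm x" for x :: 'a
    by (simp add: norm_eq_sqrt_inner inner_summand ell2_nth_summand single_def)
  have "bounded_linear (summand k :: 'a \<Rightarrow> 'a ell2)"
    by (rule bounded_linear_intro[of _ 1])
      (auto simp: norm ell2_nth_summand single_def plus_ell2.rep_eq scaleR_ell2.rep_eq intro!: ell2_eqI)
  moreover have "summand k (scaleC c x) = scaleC c (summand k x)" for c and x :: 'a
    by (auto simp: ell2_nth_summand single_def scaleC_ell2.rep_eq intro!: ell2_eqI)
  ultimately show ?thesis by (simp add: isometric_embedding_def bounded_clinear_def norm)
qed

lemma orth_proj_summand: "orth_proj (range (summand k)) f = summand k (ell2_nth f k)"
proof -
  have bcl: "bounded_clinear (summand k :: 'a \<Rightarrow> 'a ell2)"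
    by (rule isometric_embedding_summand[unfolded isometric_embedding_def, THEN conjunct1])
  then have lin: "linear (summand k :: 'a \<Rightarrow> 'a ell2)"
    by (simp add: bounded_clinear_def bounded_linear.linear)
  have "cinner (f - summand k (ell2_nth f k)) (summand k v) = 0" for v
    unfolding cinner_conv_inner
    by (simp add: inner_summand ell2_nth_summand single_def minus_ell2.rep_eq scaleC_ell2.rep_eq complex_eq_iff)
  then show ?thesis
    by (intro orth_proj_eqI) (auto simp flip: linear_diff[OF lin])
qed

lemma ell2_nth_truncation:
  "ell2_nth (\<Sum>j<n. summand j (ell2_nth f j)) i = (if i < n then ell2_nth f i else 0)"
  by (simp add: ell2_nth_sum ell2_nth_summand single_def)

text \<open>The squared error is the tail of the convergent series for the squared norm.\<close>

lemma truncation_tendsto: "(\<lambda>n. \<Sum>j<n. summand j (ell2_nth f j)) \<longlonglongrightarrow> f"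
proof -
  let ?t = "\<lambda>n. \<Sum>j<n. summand j (ell2_nth f j)"
  let ?a = "\<lambda>i. (norm (ell2_nth f i))\<^sup>2"
  have "(norm (?t n - f))\<^sup>2 = (\<Sum>i. ?a i) - (\<Sum>i<n. ?a i)" for n
  proof -
    have "(\<lambda>i. if i < n then ?a i else 0) sums (\<Sum>i<n. if i < n then ?a i else 0)"
      using sums_finite[of "{..<n}" "\<lambda>i. if i < n then ?a i else 0"] by simp
    then have "(\<lambda>i. ?a i - (if i < n then ?a i else 0)) sums ((\<Sum>i. ?a i) - (\<Sum>i<n. ?a i))"
      by (intro sums_diff summable_sums summable_ell2) simp
    moreover have "?a i - (if i < n then ?a i else 0) = (norm (ell2_nth (?t n - f) i))\<^sup>2" for i
      by (simp add: minus_ell2.rep_eq ell2_nth_truncation)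
    ultimately show ?thesis by (simp only: norm_ell2_sq sums_iff)
  qed
  moreover have "(\<lambda>n. (\<Sum>i. ?a i) - (\<Sum>i<n. ?a i)) \<longlonglongrightarrow> (\<Sum>i. ?a i) - (\<Sum>i. ?a i)"
    by (intro tendsto_intros summable_LIMSEQ summable_ell2)
  ultimately have "(\<lambda>n. (norm (?t n - f))\<^sup>2) \<longlonglongrightarrow> 0" by simp
  from tendsto_real_sqrt[OF this] have "(\<lambda>n. norm (?t n - f)) \<longlonglongrightarrow> 0" by simp
  then have "(\<lambda>n. ?t n - f) \<longlonglongrightarrow> 0" by (rule tendsto_norm_zero_cancel)
  then show ?thesis by (rule LIM_zero_cancel)
qed

section \<open>Complex subspaces and spans\<close>

lemma csubspace_cspan: "csubspace (cspan S)"
  unfolding cspan_def by (rule hull_in) (auto simp: csubspace_def)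

lemma csubspace_diff:
  assumes "csubspace M" "x \<in> M" "y \<in> M"
  shows "x - y \<in> M"
proof -
  have "scaleC (- 1) y = - y" using scaleR_scaleC[of "- 1" y] by simp
  then have "x + - y \<in> M" using assms unfolding csubspace_def by metis
  then show ?thesis by simp
qed

lemma csubspace_sum:
  assumes "csubspace M" "\<And>i. i \<in> I \<Longrightarrow> F i \<in> M"
  shows "sum F I \<in> M"
  using assms by (induction I rule: infinite_finite_induct) (auto simp: csubspace_def)

section \<open>The block matrix as a bounded self-adjoint operator\<close>

context block_lanczos
begin

lemma block_row_sums_eq: "block_row_sums B f = tri_apply B (ell2_nth f)"
proof
  fix i
  show "block_row_sums B f i = tri_apply B (ell2_nth f) i"
    unfolding block_row_sums_def tri_apply_def
    by (rule suminf_finite) (auto simp: B_zero)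
qed

text \<open>Finite sections of the isometry that sends the \<open>i\<close>-th summand into
  \<open>'k\<close> by \<open>W i\<close>. They carry bounds for \<open>C\<close> over to the matrix
  without an infinite sum in \<open>'k\<close>.\<close>

definition synth :: "nat \<Rightarrow> (nat \<Rightarrow> 'h) \<Rightarrow> 'k"
  where "synth n f = (\<Sum>i\<le>n. W i (f i))"

lemma norm_synth_sq: "(norm (synth n f))\<^sup>2 = (\<Sum>i\<le>n. (norm (f i))\<^sup>2)"
  by (simp add: power2_norm_eq_inner synth_def inner_sum_W W_inner)

lemma norm_synth_le: "norm (synth n (ell2_nth f)) \<le> norm f"
proof (rule power2_le_imp_le)
  show "(norm (synth n (ell2_nth f)))\<^sup>2 \<le> (norm f)\<^sup>2"
    unfolding norm_synth_sq norm_ell2_sq by (intro sum_le_suminf summable_ell2) auto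
qed simp

text \<open>Rows up to \<open>n\<close> read coordinates up to \<open>n + 1\<close>, hence the
  unequal truncations on the right.\<close>

lemma sum_inner_tri_apply:
  "(\<Sum>i\<le>n. inner (tri_apply B f i) (g i)) = inner (C (synth (Suc n) f)) (synth n g)"
proof -
  have "inner (tri_apply B f i) y = inner (C (synth (Suc n) f)) (W i y)" if "i \<le> n" for i y
  proof -
    have "(\<Sum>j\<le>Suc i. inner (B i j (f j)) y) = (\<Sum>j\<le>Suc n. inner (B i j (f j)) y)"
      by (rule sum.mono_neutral_left) (use that in \<open>auto simp: B_zero\<close>)
    then show ?thesis
      by (simp only: tri_apply_def synth_def linear_sum[OF C_linear] inner_sum_left B_form)
  qed
  then show ?thesis by (simp add: synth_def[of n] inner_sum_right)
qed

text \<open>Testing the truncated image against itself and cancelling one factor of its norm gives a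
  bound independent of \<open>n\<close>.\<close>

lemma tri_apply_bound:
  obtains c where "0 \<le> c" "\<And>x. norm (C x) \<le> norm x * c"
    "\<And>f n. (\<Sum>i\<le>n. (norm (tri_apply B (ell2_nth f) i))\<^sup>2) \<le> (norm f * c)\<^sup>2"
proof -
  obtain c where c: "0 \<le> c" "\<And>x. norm (C x) \<le> norm x * c"
    using bounded_linear.nonneg_bounded[of C] C_bounded_clinear by (auto simp: bounded_clinear_def)
  have "(\<Sum>i\<le>n. (norm (tri_apply B (ell2_nth f) i))\<^sup>2) \<le> (norm f * c)\<^sup>2" for f n
  proof -
    let ?g = "tri_apply B (ell2_nth f)"
    let ?t = "norm (synth n ?g)"
    have "?t * ?t = inner (C (synth (Suc n) (ell2_nth f))) (synth n ?g)"
      using norm_synth_sq[of n ?g] sum_inner_tri_apply[of "ell2_nth f" ?g n]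
      by (simp add: power2_eq_square power2_norm_eq_inner[symmetric])
    also have "\<dots> \<le> norm (C (synth (Suc n) (ell2_nth f))) * ?t" by (rule norm_cauchy_schwarz)
    also have "\<dots> \<le> (norm f * c) * ?t"
      using c(2)[of "synth (Suc n) (ell2_nth f)"] mult_right_mono[OF norm_synth_le[of "Suc n" f] c(1)]
      by (intro mult_right_mono) auto
    finally have "?t \<le> norm f * c"
      using c(1) by (cases "?t = 0") auto
    then show ?thesis unfolding norm_synth_sq[symmetric] by (intro power_mono) auto
  qed
  with c show ?thesis by (rule that)
qed

lemma summable_tri_apply: "summable (\<lambda>i. (norm (tri_apply B (ell2_nth f) i))\<^sup>2)"
proof -
  obtain c where "\<And>f n. (\<Sum>i\<le>n. (norm (tri_apply B (ell2_nth f) i))\<^sup>2) \<le> (norm f * c)\<^sup>2"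
    by (rule tri_apply_bound) blast
  moreover have "(\<Sum>i<n. (norm (tri_apply B (ell2_nth f) i))\<^sup>2)
      \<le> (\<Sum>i\<le>n. (norm (tri_apply B (ell2_nth f) i))\<^sup>2)" for n
    by (rule sum_mono2) auto
  ultimately show ?thesis
    by (intro summableI_nonneg_bounded[where x = "(norm f * c)\<^sup>2"]) (auto intro: order_trans)
qed

lemma ell2_nth_block_op: "ell2_nth (block_op B f) = tri_apply B (ell2_nth f)"
  by (simp add: block_op_def block_row_sums_eq Abs_ell2_inverse summable_tri_apply)

lemma block_op_bounded_clinear: "bounded_clinear (block_op B)"
proof -
  obtain c where c: "0 \<le> c" "\<And>f n. (\<Sum>i\<le>n. (norm (tri_apply B (ell2_nth f) i))\<^sup>2) \<le> (norm f * c)\<^sup>2"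
    by (rule tri_apply_bound) blast
  have lin: "linear (B i j)" and cl: "B i j (scaleC k x) = scaleC k (B i j x)" for i j k x
    using B_bounded_clinear[of i j] by (auto simp: bounded_clinear_def bounded_linear.linear)
  have "bounded_linear (block_op B)"
  proof (rule bounded_linear_intro)
    show "block_op B (f + g) = block_op B f + block_op B g" for f g
      by (rule ell2_eqI)
        (simp only: ell2_nth_block_op plus_ell2.rep_eq tri_apply_def linear_add[OF lin] sum.distrib)
    show "block_op B (r *\<^sub>R f) = r *\<^sub>R block_op B f" for r f
      by (rule ell2_eqI)
        (simp only: ell2_nth_block_op scaleR_ell2.rep_eq tri_apply_def linear_scale[OF lin] scaleR_sum_right)
    show "norm (block_op B f) \<le> norm f * c" for f
    proof (rule power2_le_imp_le)
      have "(\<Sum>i. (norm (tri_apply B (ell2_nth f) i))\<^sup>2) \<le> (norm f * c)\<^sup>2"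
      proof (rule suminf_le_const[OF summable_tri_apply])
        fix n
        have "(\<Sum>i<n. (norm (tri_apply B (ell2_nth f) i))\<^sup>2)
            \<le> (\<Sum>i\<le>n. (norm (tri_apply B (ell2_nth f) i))\<^sup>2)"
          by (rule sum_mono2) auto
        then show "(\<Sum>i<n. (norm (tri_apply B (ell2_nth f) i))\<^sup>2) \<le> (norm f * c)\<^sup>2"
          using c(2)[of f n] by linarith
      qed
      then show "(norm (block_op B f))\<^sup>2 \<le> (norm f * c)\<^sup>2"
        by (simp only: norm_ell2_sq ell2_nth_block_op)
    qed (simp add: c)
  qed
  moreover have "block_op B (scaleC k f) = scaleC k (block_op B f)" for k f
    by (rule ell2_eqI)
      (simp only: ell2_nth_block_op scaleC_ell2.rep_eq tri_apply_def cl scaleC_sum)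
  ultimately show ?thesis by (simp add: bounded_clinear_def)
qed

text \<open>The partial sums of the two sides differ only by boundary terms in the coordinates \<open>n + 1\<close>,
  which tend to \<open>0\<close>.\<close>

lemma block_op_symmetric: "inner (block_op B f) g = inner f (block_op B g)"
proof -
  let ?f = "ell2_nth f" and ?g = "ell2_nth g"
  obtain c where c: "0 \<le> c" "\<And>x. norm (C x) \<le> norm x * c"
    by (rule tri_apply_bound) blast
  define D where "D n = (\<Sum>i\<le>n. inner (tri_apply B ?f i) (?g i)) - (\<Sum>i\<le>n. inner (?f i) (tri_apply B ?g i))" for n
  have lim: "D \<longlonglongrightarrow> inner (block_op B f) g - inner f (block_op B g)"
    using sums_inner_ell2[of "block_op B f" g] sums_inner_ell2[of f "block_op B g"]
    unfolding D_def[abs_def] sums_def_le ell2_nth_block_op by (rule tendsto_diff)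
  have bound: "norm (D n) \<le> norm (?f (Suc n)) * c * norm g + norm f * c * norm (?g (Suc n))" for n
  proof -
    have norm_W: "norm (W i x) = norm x" for i x
      by (simp add: norm_eq_sqrt_inner W_inner)
    have "(\<Sum>i\<le>n. inner (?f i) (tri_apply B ?g i)) = inner (C (synth n ?f)) (synth (Suc n) ?g)"
      using sum_inner_tri_apply[of ?g ?f n] by (simp add: inner_commute C_symmetric)
    moreover have "synth (Suc n) h = synth n h + W (Suc n) (h (Suc n))" for h
      by (simp add: synth_def)
    \<comment> \<open>The common term \<open>inner (C (synth n ?f)) (synth n ?g)\<close>
      cancels.\<close>
    ultimately have D: "D n = inner (C (W (Suc n) (?f (Suc n)))) (synth n ?g)
        - inner (C (synth n ?f)) (W (Suc n) (?g (Suc n)))"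
      unfolding D_def sum_inner_tri_apply
      by (simp add: inner_add linear_add[OF C_linear] del: W.simps)
    have C_bound: "\<bar>inner (C x) y\<bar> \<le> norm x * c * norm y" for x y
      using Cauchy_Schwarz_ineq2[of "C x" y] mult_right_mono[OF c(2)[of x] norm_ge_zero[of y]] by linarith
    have "norm (D n) \<le> norm (?f (Suc n)) * c * norm (synth n ?g)
        + norm (synth n ?f) * c * norm (?g (Suc n))"
      using C_bound[of "W (Suc n) (?f (Suc n))" "synth n ?g"]
        C_bound[of "synth n ?f" "W (Suc n) (?g (Suc n))"]
      unfolding norm_W D real_norm_def by linarith
    also have "\<dots> \<le> norm (?f (Suc n)) * c * norm g + norm f * c * norm (?g (Suc n))"
      by (intro add_mono mult_mono norm_synth_le) (simp_all add: c)
    finally show ?thesis .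
  qed
  have "(\<lambda>n. norm (?f (Suc n)) * c * norm g + norm f * c * norm (?g (Suc n)))
      \<longlonglongrightarrow> 0 * c * norm g + norm f * c * 0"
    by (intro tendsto_intros LIMSEQ_Suc ell2_nth_tendsto_0)
  then have "D \<longlonglongrightarrow> 0"
    using bound by (intro Lim_null_comparison[of D]) auto
  with lim show ?thesis using LIMSEQ_unique by fastforce
qed

section \<open>Moments and minimality\<close>

lemma block_op_power_summand:
  "ell2_nth ((block_op B ^^ k) (summand 0 x)) = (tri_apply B ^^ k) (single 0 x)"
  by (induction k) (simp_all add: ell2_nth_summand ell2_nth_block_op)

text \<open>Cutting nothing: \<open>block_cut UNIV\<close> is \<open>B\<close>, so the expansion
  holds for the full matrix and every power.\<close>

lemma krylov_B:
  shows "k < i \<Longrightarrow> (tri_apply B ^^ k) (single 0 x) i = 0"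
    and "(tri_apply B ^^ k) (single 0 x) k = block_P B k x"
    and "(\<Sum>i\<le>k. W i ((tri_apply B ^^ k) (single 0 x) i)) = (C ^^ k) (V x)"
proof -
  have "block_cut UNIV = B" by (intro ext) (simp add: block_cut_def)
  then show "k < i \<Longrightarrow> (tri_apply B ^^ k) (single 0 x) i = 0"
    "(tri_apply B ^^ k) (single 0 x) k = block_P B k x"
    "(\<Sum>i\<le>k. W i ((tri_apply B ^^ k) (single 0 x) i)) = (C ^^ k) (V x)"
    using krylov[of k UNIV k x] by (auto simp: B_0 W_linear)
qed

text \<open>Pairing the expansion of \<open>C^k V x\<close> with \<open>W 0\<close>, which is
  \<open>V\<close>, isolates the zeroth coordinate.\<close>

lemma krylov_zeroth: "(tri_apply B ^^ k) (single 0 x) 0 = A k x"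
proof (rule inner_eqI)
  fix y
  let ?t = "(tri_apply B ^^ k) (single 0 x)"
  have "inner (A k x) y = (\<Sum>i\<le>k. inner (W i (?t i)) (W 0 y))"
    by (simp add: moment krylov_B(3)[symmetric] inner_sum_left)
  also have "\<dots> = (\<Sum>i\<le>k. if i = 0 then inner (?t 0) y else 0)"
    by (intro sum.cong refl) (simp add: W_inner del: W.simps)
  finally show "inner (?t 0) y = inner (A k x) y" by simp
qed

lemma selfadjoint_dilation_block_op: "selfadjoint_dilation (summand 0) (block_op B) A"
  unfolding selfadjoint_dilation_def
  by (simp add: isometric_embedding_summand selfadjoint_op_iff block_op_bounded_clinear block_op_symmetric
      orth_proj_summand block_op_power_summand krylov_zeroth)

text \<open>Triangular elimination: the \<open>i\<close>-th power applied to a preimage of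
  \<open>y\<close> under \<open>block_P B i\<close> has \<open>y\<close> in coordinate
  \<open>i\<close> and zeros above, and its lower coordinates are removed by induction.\<close>

lemma summand_in_krylov_span: "summand i y \<in> cspan {(block_op B ^^ n) (summand 0 h) | n h. True}"
proof (induction i arbitrary: y rule: less_induct)
  case (less i)
  let ?M = "cspan {(block_op B ^^ n) (summand 0 h) | n h. True}"
  obtain x where x: "y = block_P B i x" using bij_P[of i] by (metis bij_pointE)
  let ?f = "(block_op B ^^ i) (summand 0 x)"
  have "?f \<in> ?M" unfolding cspan_def by (rule hull_inc) blast
  moreover have "(\<Sum>j<i. summand j (ell2_nth ?f j)) \<in> ?M"
    by (intro csubspace_sum csubspace_cspan less) simp
  moreover have "summand i y = ?f - (\<Sum>j<i. summand j (ell2_nth ?f j))"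
  proof (rule ell2_eqI)
    fix k
    have "single i y k = ell2_nth ?f k - (if k < i then ell2_nth ?f k else 0)"
      unfolding block_op_power_summand using krylov_B(1)[of i k x] krylov_B(2)[of i x]
      by (auto simp: single_def[of i] x)
    then show "ell2_nth (summand i y) k = ell2_nth (?f - (\<Sum>j<i. summand j (ell2_nth ?f j))) k"
      by (simp only: ell2_nth_summand minus_ell2.rep_eq ell2_nth_truncation)
  qed
  ultimately show ?case by (simp only: csubspace_diff[OF csubspace_cspan])
qed

lemma minimal_dilation_block_op: "minimal_dilation zeroth_summand (block_op B) A"
proof -
  let ?M = "cspan {(block_op B ^^ n) (summand 0 h) | n h. True}"
  have "f \<in> closure ?M" for f
    unfolding closure_sequential
    by (intro exI[of _ "\<lambda>n. \<Sum>j<n. summand j (ell2_nth f j)"] conjI allI truncation_tendsto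
        csubspace_sum csubspace_cspan summand_in_krylov_span)
  then show ?thesis
    by (auto simp: minimal_dilation_def zeroth_summand_eq selfadjoint_dilation_block_op)
qed

end

text \<open>The first three conjuncts express well-definedness: the square roots are taken of
  positive operators, the blocks are bounded, and \<open>Abs_ell2\<close> in \<open>block_op\<close>
  receives square-summable sequences.\<close>

theorem theorem2p7:
  fixes A :: "nat \<Rightarrow> 'h::chilbert_space \<Rightarrow> 'h"
    and B :: "nat \<Rightarrow> nat \<Rightarrow> 'h \<Rightarrow> 'h"
    and V :: "'h \<Rightarrow> 'k::chilbert_space"
    and C :: "'k \<Rightarrow> 'k"
  assumes selfadjoint: "\<And>n. selfadjoint_op (A n)"
    and unit: "A 0 = id"
    and dilation: "selfadjoint_dilation V C A"
    and recurrence: "block_recurrence A B"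
    and invertible: "\<And>n. boundedly_invertible (block_P B n)"
  shows "(\<forall>n\<ge>1. positive_op (radicand A B n)) \<and>
    (\<forall>i j. bounded_clinear (B i j)) \<and>
    (\<forall>f. summable (\<lambda>i. (norm (block_row_sums B f i))\<^sup>2)) \<and>
    minimal_dilation zeroth_summand (block_op B) A"
proof -
  have V: "isometric_embedding V" and C: "selfadjoint_op C"
    and proj: "\<And>n h. V (A n h) = orth_proj (range V) ((C ^^ n) (V h))"
    using dilation by (auto simp: selfadjoint_dilation_def)
  interpret block_lanczos A B V C
  proof
    show "bounded_clinear V" using V by (simp add: isometric_embedding_def)
    show "inner (V x) (V y) = inner x y" for x y by (rule isometric_embedding_inner[OF V])
    show "inner (A n x) y = inner ((C ^^ n) (V x)) (V y)" for n x y
      using inner_orth_proj_range[OF V, of "(C ^^ n) (V x)" y]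
      by (simp add: proj[symmetric] isometric_embedding_inner[OF V])
  qed (use C recurrence invertible in auto)
  have "positive_op (radicand A B n)" if "1 \<le> n" for n
    using radicand_positive[of "n - 1"] that by simp
  then show ?thesis
    by (simp add: B_bounded_clinear block_row_sums_eq summable_tri_apply minimal_dilation_block_op)
qed

end
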